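(* (Relations for $I_{n,m}$ and $I^1_{n,m}$.) Let $\mathcal L$ be a positive definite linear functional on $\prod^{N,M}$. For $0\le n\le N$, $0\le m\le M$, $$I_{n,m}\tilde\Gamma_{n,m}^\dagger=-\Gamma_{n,m}^\dagger\mathcal K_{n,m},$$ and, for $0<n\le N$, $0\le m\le M$, $$I^1_{n,m}=-\overline{A_{n,m}}^{\,-1}\,\hat E_{n,m}^\dagger A_{n,m}I_{n,m}+A_{n,m}^TI^1_{n-1,m}\tilde\Gamma_{n,m}.$$
   Context: $\prod^{N,M}=\mathrm{span}\{z^iw^j:|i|\le N,|j|\le M\}$, $\hat\prod^{N,M}=\mathrm{span}\{z^iw^j:0\le i\le N,0\le j\le M\}$. For a (matrix valued) Laurent polynomial $Q$, $Q^\dagger(z,w)=Q(1/\bar z,1/\bar w)^\dagger$. A linear functional $\mathcal L$ on $\prod^{N,M}$ with $\mathcal L(z^{-i}w^{-j})=\overline{\mathcal L(z^iw^j)}$ is positive definite if $\mathcal L(pp^\dagger)>0$ for all nonzero $p\in\hat\prod^{N,M}$. It is applied entrywise and, for column vectors, $\langle X,Y\rangle=\mathcal L(XY^\dagger)$. Bars on matrices are entrywise conjugates. For $0\le l\le m$, $\phi^l_{n,m}$ is the unique element of $\mathrm{span}(\{z^iw^j:0\le i<n,0\le j\le m\}\cup\{z^nw^j:0\le j\le l\})$ with positive coefficient of $z^nw^l$, $\langle\phi^l_{n,m},\phi^l_{n,m}\rangle=1$, orthogonal to all of these monomials except $z^nw^l$; $\Phi_{n,m}=[\phi^m_{n,m},\dots,\phi^0_{n,m}]^T$.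 For $0\le l\le n$, $\tilde\phi^l_{n,m}$ is the unique element of $\mathrm{span}(\{z^iw^j:0\le i\le n,0\le j<m\}\cup\{z^iw^m:0\le i\le l\})$ with positive coefficient of $z^lw^m$, norm one, orthogonal to all of these monomials except $z^lw^m$; $\tilde\Phi_{n,m}=[\tilde\phi^n_{n,m},\dots,\tilde\phi^0_{n,m}]^T$. The reversal is the row vector $\overleftarrow\Phi_{n,m}(z,w)=z^nw^m\Phi_{n,m}(1/\bar z,1/\bar w)^\dagger$. $\Phi_{n,-1}$ and $\tilde\Phi_{-1,m}$ are empty; matrices with zero rows or columns are empty, and products over an empty index are zero. Coefficients: $\hat E_{n,m}=\langle z\Phi_{n-1,m},\overleftarrow\Phi_{n-1,m}^T\rangle$, $A_{n,m}=\langle z\Phi_{n-1,m},\Phi_{n,m}\rangle$ ($n\ge1$; $A_{n,m}$ is invertible), $\mathcal K_{n,m}=\langle\Phi_{n,m-1},\tilde\Phi_{n-1,m}\rangle$, $\Gamma_{n,m}=\langle\Phi_{n,m-1},\Phi_{n,m}\rangle$, $\tilde\Gamma_{n,m}=\langle\tilde\Phi_{n-1,m},\tilde\Phi_{n,m}\rangle$, $I_{n,m}=\langle\Phi_{n,m},\tilde\Phi_{n,m}\rangle$, $I^1_{n,m}=\langle\overleftarrow\Phi_{n,m}^T,\tilde\Phi_{n,m}\rangle$. *)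

theory Defs
  imports
    "HOL-Library.Poly_Mapping"
    "HOL-Library.Product_Plus"
    "Jordan_Normal_Form.Matrix"
    "Jordan_Normal_Form.Gauss_Jordan_Elimination"
    "Jordan_Normal_Form.Schur_Decomposition"
begin

subsection \<open>Laurent polynomials in two variables\<close>

text \<open>
  The key \<open>(i, j)\<close> carries the coefficient of \<open>z^i w^j\<close>; the convolution product of
  \<open>Poly_Mapping\<close> is then the product of Laurent polynomials.
\<close>

type_synonym laurent = "(int \<times> int) \<Rightarrow>\<^sub>0 complex"

definition mono_zw :: "int \<times> int \<Rightarrow> laurent" where
  "mono_zw k = Poly_Mapping.single k 1"

definition lscale :: "complex \<Rightarrow> laurent \<Rightarrow> laurent" where
  "lscale c p = Poly_Mapping.single 0 c * p"

interpretation laurent: Vector_Spaces.vector_space lscale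
  by unfold_locales
    (simp_all add: lscale_def distrib_left distrib_right single_add mult_single mult.assoc [symmetric])

definition Laurent_space :: "int \<Rightarrow> int \<Rightarrow> laurent set" where
  "Laurent_space N M = laurent.span (mono_zw ` {(i, j). \<bar>i\<bar> \<le> N \<and> \<bar>j\<bar> \<le> M})"

definition Poly_space :: "int \<Rightarrow> int \<Rightarrow> laurent set" where
  "Poly_space N M = laurent.span (mono_zw ` ({0..N} \<times> {0..M}))"

lift_definition ldagger :: "laurent \<Rightarrow> laurent" is "\<lambda>p k. cnj (p (- k))"
proof -
  fix p :: "int \<times> int \<Rightarrow> complex"
  assume fin: "finite {k. p k \<noteq> 0}"
  have "{k. cnj (p (- k)) \<noteq> 0} = uminus ` {k. p k \<noteq> 0}"
    by (force simp: image_iff intro: exI [of _ "- k" for k])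
  with fin show "finite {k. cnj (p (- k)) \<noteq> 0}"
    by simp
qed

text \<open>The coefficientwise \<open>ldagger\<close> is the operation \<open>p(1 / cnj z, 1 / cnj w)\<close>, conjugated:\<close>

definition leval :: "laurent \<Rightarrow> complex \<Rightarrow> complex \<Rightarrow> complex" where
  "leval p z w = (\<Sum>(i, j)\<in>Poly_Mapping.keys p. Poly_Mapping.lookup p (i, j) * z powi i * w powi j)"

lemma leval_ldagger:
  "leval (ldagger p) z w = cnj (leval p (1 / cnj z) (1 / cnj w))"
proof -
  have keys: "Poly_Mapping.keys (ldagger p) = uminus ` Poly_Mapping.keys p"
    by (force simp: in_keys_iff ldagger.rep_eq image_iff intro: exI [of _ "- k" for k])
  have "leval (ldagger p) z w =
      (\<Sum>k\<in>Poly_Mapping.keys p. cnj (Poly_Mapping.lookup p k) * z powi (- fst k) * w powi (- snd k))"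
    unfolding leval_def keys
    by (subst sum.reindex) (auto simp: inj_on_def ldagger.rep_eq case_prod_beta intro!: sum.cong)
  also have "\<dots> = cnj (leval p (1 / cnj z) (1 / cnj w))"
    unfolding leval_def
    by (auto simp: cnj_sum case_prod_beta power_int_minus power_int_divide_distrib
        divide_inverse power_int_inverse intro!: sum.cong)
  finally show ?thesis .
qed

definition mat_ldagger :: "laurent mat \<Rightarrow> laurent mat" where
  "mat_ldagger Q = map_mat ldagger (transpose_mat Q)"


subsection \<open>Linear functionals\<close>

text \<open>
  A functional is a total function of which only the values on \<open>Laurent_space N M\<close> matter.
  On \<open>complex\<close>, \<open>0 < c\<close> means that \<open>c\<close> is real and positive.
\<close>

definition linear_functional :: "int \<Rightarrow> int \<Rightarrow> (laurent \<Rightarrow> complex) \<Rightarrow> bool" where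
  "linear_functional N M L \<longleftrightarrow>
     (\<forall>p\<in>Laurent_space N M. \<forall>q\<in>Laurent_space N M. L (p + q) = L p + L q) \<and>
     (\<forall>c. \<forall>p\<in>Laurent_space N M. L (lscale c p) = c * L p) \<and>
     (\<forall>i j. \<bar>i\<bar> \<le> N \<and> \<bar>j\<bar> \<le> M \<longrightarrow> L (mono_zw (- i, - j)) = cnj (L (mono_zw (i, j))))"

definition positive_definite :: "int \<Rightarrow> int \<Rightarrow> (laurent \<Rightarrow> complex) \<Rightarrow> bool" where
  "positive_definite N M L \<longleftrightarrow> (\<forall>p\<in>Poly_space N M. p \<noteq> 0 \<longrightarrow> 0 < L (p * ldagger p))"

definition ip :: "(laurent \<Rightarrow> complex) \<Rightarrow> laurent \<Rightarrow> laurent \<Rightarrow> complex" where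
  "ip L p q = L (p * ldagger q)"

text \<open>For column vectors \<open>X\<close>, \<open>Y\<close> of Laurent polynomials (matrices with one column).\<close>

definition ip_mat :: "(laurent \<Rightarrow> complex) \<Rightarrow> laurent mat \<Rightarrow> laurent mat \<Rightarrow> complex mat" where
  "ip_mat L X Y = map_mat L (X * mat_ldagger Y)"


subsection \<open>Orthonormal polynomials\<close>

definition ortho_poly :: "(laurent \<Rightarrow> complex) \<Rightarrow> (int \<times> int) set \<Rightarrow> int \<times> int \<Rightarrow> laurent" where
  "ortho_poly L S t =
     (THE p. p \<in> laurent.span (mono_zw ` S) \<and> 0 < Poly_Mapping.lookup p t \<and>
        ip L p p = 1 \<and> (\<forall>s\<in>S - {t}. ip L p (mono_zw s) = 0))"

definition phi :: "(laurent \<Rightarrow> complex) \<Rightarrow> int \<Rightarrow> int \<Rightarrow> int \<Rightarrow> laurent" where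
  "phi L n m l = ortho_poly L ({0..<n} \<times> {0..m} \<union> {n} \<times> {0..l}) (n, l)"

definition tphi :: "(laurent \<Rightarrow> complex) \<Rightarrow> int \<Rightarrow> int \<Rightarrow> int \<Rightarrow> laurent" where
  "tphi L n m l = ortho_poly L ({0..n} \<times> {0..<m} \<union> {0..l} \<times> {m}) (l, m)"

text \<open>
  Indices are integers so that \<open>Phi L n (- 1)\<close> and \<open>tPhi L (- 1) m\<close> are the empty columns.
  Row \<open>r\<close> of \<open>Phi L n m\<close> has superscript \<open>m - r\<close>.
\<close>

definition Phi :: "(laurent \<Rightarrow> complex) \<Rightarrow> int \<Rightarrow> int \<Rightarrow> laurent mat" where
  "Phi L n m = mat (nat (m + 1)) 1 (\<lambda>(r, _). phi L n m (m - int r))"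

definition tPhi :: "(laurent \<Rightarrow> complex) \<Rightarrow> int \<Rightarrow> int \<Rightarrow> laurent mat" where
  "tPhi L n m = mat (nat (n + 1)) 1 (\<lambda>(r, _). tphi L n m (n - int r))"

definition revPhi :: "(laurent \<Rightarrow> complex) \<Rightarrow> int \<Rightarrow> int \<Rightarrow> laurent mat" where
  "revPhi L n m = mono_zw (n, m) \<cdot>\<^sub>m mat_ldagger (Phi L n m)"


subsection \<open>Recurrence coefficients\<close>

definition hatE :: "(laurent \<Rightarrow> complex) \<Rightarrow> int \<Rightarrow> int \<Rightarrow> complex mat" where
  "hatE L n m = ip_mat L (mono_zw (1, 0) \<cdot>\<^sub>m Phi L (n - 1) m) (transpose_mat (revPhi L (n - 1) m))"

definition coeffA :: "(laurent \<Rightarrow> complex) \<Rightarrow> int \<Rightarrow> int \<Rightarrow> complex mat" where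
  "coeffA L n m = ip_mat L (mono_zw (1, 0) \<cdot>\<^sub>m Phi L (n - 1) m) (Phi L n m)"

definition coeffK :: "(laurent \<Rightarrow> complex) \<Rightarrow> int \<Rightarrow> int \<Rightarrow> complex mat" where
  "coeffK L n m = ip_mat L (Phi L n (m - 1)) (tPhi L (n - 1) m)"

definition coeffG :: "(laurent \<Rightarrow> complex) \<Rightarrow> int \<Rightarrow> int \<Rightarrow> complex mat" where
  "coeffG L n m = ip_mat L (Phi L n (m - 1)) (Phi L n m)"

definition tcoeffG :: "(laurent \<Rightarrow> complex) \<Rightarrow> int \<Rightarrow> int \<Rightarrow> complex mat" where
  "tcoeffG L n m = ip_mat L (tPhi L (n - 1) m) (tPhi L n m)"

definition coeffI :: "(laurent \<Rightarrow> complex) \<Rightarrow> int \<Rightarrow> int \<Rightarrow> complex mat" where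
  "coeffI L n m = ip_mat L (Phi L n m) (tPhi L n m)"

definition coeffI1 :: "(laurent \<Rightarrow> complex) \<Rightarrow> int \<Rightarrow> int \<Rightarrow> complex mat" where
  "coeffI1 L n m = ip_mat L (transpose_mat (revPhi L n m)) (tPhi L n m)"

text \<open>
  \<open>mat_inverse\<close> returns \<open>None\<close> on singular matrices, where \<open>mat_inv\<close> is thus unspecified.
\<close>

definition mat_inv :: "complex mat \<Rightarrow> complex mat" where
  "mat_inv A = the (mat_inverse A)"

end

theory Submission
  imports Defs
begin

text \<open>
  Since \<open>Phi n m\<close> is orthogonal to the polynomials of degree less than \<open>n\<close> in \<open>z\<close>, its projection onto those of
  degree less than \<open>m\<close> in \<open>w\<close> is \<open>\<Gamma>\<^sup>\<dagger> Phi n (m - 1)\<close>, hence \<open>Phi n m - \<Gamma>\<^sup>\<dagger> Phi n (m - 1) = I tPhi n m\<close>;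
  pairing with \<open>tPhi (n - 1) m\<close> is the first relation.

  For the second one, write \<open>R = revPhi (n - 1) m\<close> transposed, \<open>Z = z Phi (n - 1) m\<close> and \<open>E = hatE n m\<close>. Then
  \<open>A Phi n m = Z - E R\<close>, which gives \<open>A A\<^sup>\<dagger> = 1 - E E\<^sup>\<dagger>\<close>, and reversal turns it into
  \<open>cnj A revPhi n m = R - E\<^sup>\<dagger> Z\<close>, because \<open>E\<close> is symmetric. Eliminating \<open>Z\<close> yields
  \<open>revPhi n m = A\<^sup>T R - (cnj A)\<^sup>-\<^sup>1 E\<^sup>\<dagger> A Phi n m\<close>, to be paired with \<open>tPhi n m\<close>. As \<open>R\<close> agrees with
  \<open>I1 (n - 1) m tPhi (n - 1) m\<close> up to terms of degree less than \<open>m\<close> in \<open>w\<close>, its pairing with \<open>tPhi n m\<close> is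
  \<open>I1 (n - 1) m\<close> times \<open>tcoeffG n m\<close>.
\<close>

subsection \<open>Spans of monomials\<close>

abbreviation lspan :: "(int \<times> int) set \<Rightarrow> laurent set" where
  "lspan S \<equiv> laurent.span (mono_zw ` S)"

text \<open>The embedding of the constants as a ring homomorphism: mapped over a complex matrix, it
  gives a matrix over Laurent polynomials that can multiply columns such as
  \<open>Phi\<close>.\<close>

definition lconst :: "complex \<Rightarrow> laurent" where
  "lconst c = Poly_Mapping.single 0 c"

lemma lconst_mult_conv_lscale: "lconst c * p = lscale c p"
  by (simp add: lconst_def lscale_def)

interpretation lconst: comm_ring_hom lconst
  by unfold_locales (simp_all add: lconst_def single_add mult_single)

text \<open>Each Laurent polynomial is the finite sum of its terms, so statements that survive
  addition need checking on single terms only.\<close>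

lemma laurent_induct [case_names single add]:
  fixes p :: laurent
  assumes single: "\<And>k c. P (Poly_Mapping.single k c)"
    and add: "\<And>p q. P p \<Longrightarrow> P q \<Longrightarrow> P (p + q)"
  shows "P p"
proof -
  have "P (\<Sum>k\<in>A. Poly_Mapping.single k (Poly_Mapping.lookup p k))" if "finite A" for A
    using that
  proof (induction A)
    case empty
    show ?case using single[of 0 0] by simp
  qed (simp add: single add)
  moreover have "p = (\<Sum>k\<in>Poly_Mapping.keys p. Poly_Mapping.single k (Poly_Mapping.lookup p k))"
    by (rule poly_mapping_eqI)
      (auto simp: lookup_sum lookup_single when_def in_keys_iff sum.delta)
  ultimately show ?thesis by (metis finite_keys)
qed

lemma lookup_single_mult:
  "Poly_Mapping.lookup (Poly_Mapping.single a c * p) k = c * Poly_Mapping.lookup p (k - a)"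
  for p :: laurent
proof (induction p rule: laurent_induct)
  case (single j d)
  have "a + j = k \<longleftrightarrow> j = k - a" by (auto simp: algebra_simps)
  then show ?case by (simp add: mult_single lookup_single when_def)
qed (simp add: distrib_left lookup_add)

lemma lookup_lconst_mult [simp]:
  "Poly_Mapping.lookup (lconst c * p) k = c * Poly_Mapping.lookup p k"
  by (simp add: lconst_def lookup_single_mult)

lemma lookup_mono_mult [simp]:
  "Poly_Mapping.lookup (mono_zw a * p) k = Poly_Mapping.lookup p (k - a)"
  by (simp add: mono_zw_def lookup_single_mult)

lemma lookup_mono: "Poly_Mapping.lookup (mono_zw a) k = (if k = a then 1 else 0)"
  by (simp add: mono_zw_def lookup_single when_def)

lemma mono_mult_mono: "mono_zw a * mono_zw b = mono_zw (a + b)"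
  by (simp add: mono_zw_def mult_single)

lemma mono_zero [simp]: "mono_zw 0 = 1"
  by (simp add: mono_zw_def)

text \<open>Distinct monomials are linearly independent, so membership in their span is a condition
  on the support and can be tested coefficient by coefficient.\<close>

lemma lspan_iff: "p \<in> lspan S \<longleftrightarrow> Poly_Mapping.keys p \<subseteq> S"
proof
  assume "p \<in> lspan S"
  then show "Poly_Mapping.keys p \<subseteq> S"
  proof (induction rule: laurent.span_induct)
    case base
    show "laurent.subspace {p. Poly_Mapping.keys p \<subseteq> S}"
      unfolding laurent.subspace_def
      by (auto simp: lconst_mult_conv_lscale[symmetric] in_keys_iff lookup_add dest!: subsetD)
  qed (auto simp: mono_zw_def)
next
  assume S: "Poly_Mapping.keys p \<subseteq> S"
  have "p = (\<Sum>k\<in>Poly_Mapping.keys p. lscale (Poly_Mapping.lookup p k) (mono_zw k))"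
    by (rule poly_mapping_eqI)
      (auto simp: lconst_mult_conv_lscale[symmetric] lookup_sum lookup_mono in_keys_iff
        if_distrib[of "(*) _"] sum.delta' cong: if_cong)
  also have "\<dots> \<in> lspan S"
    using S by (intro laurent.span_sum laurent.span_scale laurent.span_base) auto
  finally show "p \<in> lspan S" .
qed

lemma lspan_iff_lookup: "p \<in> lspan S \<longleftrightarrow> (\<forall>k. k \<notin> S \<longrightarrow> Poly_Mapping.lookup p k = 0)"
  by (auto simp: lspan_iff in_keys_iff)

lemma lspan_lookup_eq_0: "p \<in> lspan S \<Longrightarrow> k \<notin> S \<Longrightarrow> Poly_Mapping.lookup p k = 0"
  unfolding lspan_iff_lookup by blast

lemma lspan_mono: "S \<subseteq> T \<Longrightarrow> lspan S \<subseteq> lspan T"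
  by (auto simp: lspan_iff)

lemma lspan_lconst_mult: "p \<in> lspan S \<Longrightarrow> lconst c * p \<in> lspan S"
  by (simp add: lspan_iff_lookup)

lemma lspan_lead:
  assumes "p \<in> lspan (insert t S)" "Poly_Mapping.lookup p t = 0"
  shows "p \<in> lspan S"
  using assms unfolding lspan_iff_lookup by (metis insert_iff)

subsection \<open>The involution and the reversal\<close>

lemma ldagger_add: "ldagger (p + q) = ldagger p + ldagger q"
  by (rule poly_mapping_eqI) (simp add: ldagger.rep_eq lookup_add)

lemma ldagger_ldagger [simp]: "ldagger (ldagger p) = p"
  by (rule poly_mapping_eqI) (simp add: ldagger.rep_eq)

lemma ldagger_single: "ldagger (Poly_Mapping.single k c) = Poly_Mapping.single (- k) (cnj c)"
proof (rule poly_mapping_eqI)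
  fix j
  have "- j = k \<longleftrightarrow> j = - k" by (metis minus_minus)
  then show "Poly_Mapping.lookup (ldagger (Poly_Mapping.single k c)) j =
      Poly_Mapping.lookup (Poly_Mapping.single (- k) (cnj c)) j"
    by (auto simp: ldagger.rep_eq lookup_single when_def)
qed

lemma ldagger_lconst [simp]: "ldagger (lconst c) = lconst (cnj c)"
  by (simp add: lconst_def ldagger_single)

lemma ldagger_mono [simp]: "ldagger (mono_zw k) = mono_zw (- k)"
  by (simp add: mono_zw_def ldagger_single)

lemma ldagger_mult: "ldagger (p * q) = ldagger p * ldagger q"
proof (induction p rule: laurent_induct)
  case (single j c)
  show ?case
    by (rule poly_mapping_eqI)
      (simp add: ldagger_single lookup_single_mult ldagger.rep_eq)
qed (simp add: distrib_right ldagger_add)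

interpretation ldagger: comm_ring_hom ldagger
proof
  show "ldagger 1 = 1" using ldagger_lconst[of 1] by (simp del: ldagger_lconst)
qed (simp_all add: ldagger_add ldagger_mult poly_mapping_eq_iff ldagger.rep_eq fun_eq_iff)

text \<open>For \<open>a = (n, m)\<close> this is the entrywise form of the reversal in \<open>revPhi\<close>.\<close>

definition lrev :: "int \<times> int \<Rightarrow> laurent \<Rightarrow> laurent" where
  "lrev a p = mono_zw a * ldagger p"

lemma lookup_lrev: "Poly_Mapping.lookup (lrev a p) k = cnj (Poly_Mapping.lookup p (a - k))"
  by (simp add: lrev_def ldagger.rep_eq)

lemma lrev_lrev [simp]: "lrev a (lrev a p) = p"
  by (rule poly_mapping_eqI) (simp add: lookup_lrev)

text \<open>For \<open>a = (n, m)\<close> and \<open>b = (1, 0)\<close>: reversing the entries of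
  \<open>z Phi (n - 1) m\<close> at degree \<open>(n, m)\<close> yields those of
  \<open>revPhi (n - 1) m\<close>.\<close>

lemma lrev_mono_mult: "lrev a (mono_zw b * p) = lrev (a - b) p"
  by (rule poly_mapping_eqI) (simp add: lookup_lrev diff_diff_eq add.commute)

lemma lrev_lspan:
  assumes "p \<in> lspan S" "\<And>k. k \<in> S \<Longrightarrow> a - k \<in> T"
  shows "lrev a p \<in> lspan T"
  unfolding lspan_iff_lookup lookup_lrev
proof (intro allI impI)
  fix k assume "k \<notin> T"
  then have "a - k \<notin> S" using assms(2)[of "a - k"] by auto
  then show "cnj (Poly_Mapping.lookup p (a - k)) = 0" using lspan_lookup_eq_0[OF assms(1)] by simp
qed

subsection \<open>Positive definite functionals and orthonormal polynomials\<close>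

text \<open>Linearity and hermitian symmetry are imposed on all Laurent polynomials, which frees the
  calculus of inner products from side conditions; positivity stays confined to the box. The last
  subsection reduces a given functional to this situation.\<close>

locale pd_functional =
  fixes N M :: int and F :: "laurent \<Rightarrow> complex"
  assumes F_add: "F (p + q) = F p + F q"
    and F_lconst: "F (lconst c * p) = c * F p"
    and F_ldagger: "F (ldagger p) = cnj (F p)"
    and F_pos: "p \<in> Poly_space N M \<Longrightarrow> p \<noteq> 0 \<Longrightarrow> 0 < F (p * ldagger p)"
begin

abbreviation iprod :: "laurent \<Rightarrow> laurent \<Rightarrow> complex" where
  "iprod \<equiv> ip F"

section \<open>Sesquilinearity of the inner product, and its behaviour under monomial factors and
  reversal\<close>

lemma F_zero [simp]: "F 0 = 0"
  using F_lconst[of 0 0] by simp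

lemma F_sum: "F (\<Sum>i\<in>I. f i) = (\<Sum>i\<in>I. F (f i))"
  by (induction I rule: infinite_finite_induct) (simp_all add: F_add)

lemma ip_add_left: "iprod (p + q) r = iprod p r + iprod q r"
  by (simp add: ip_def F_add distrib_right)

lemma ip_lconst_left: "iprod (lconst c * p) r = c * iprod p r"
  by (simp add: ip_def F_lconst mult.assoc)

lemma ip_cnj: "cnj (iprod p q) = iprod q p"
  by (simp add: ip_def F_ldagger[symmetric] ldagger_mult mult.commute)

lemma ip_diff_left: "iprod (p - q) r = iprod p r - iprod q r"
  using ip_add_left[of "p - q" q r] by simp

lemma ip_add_right: "iprod r (p + q) = iprod r p + iprod r q"
  by (simp add: ip_cnj[of _ r, symmetric] ip_add_left)

lemma ip_lconst_right: "iprod r (lconst c * p) = cnj c * iprod r p"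
  by (simp add: ip_cnj[of _ r, symmetric] ip_lconst_left)

lemma ip_diff_right: "iprod r (p - q) = iprod r p - iprod r q"
  by (simp add: ip_cnj[of _ r, symmetric] ip_diff_left)

lemma ip_zero [simp]: "iprod 0 r = 0" "iprod r 0 = 0"
  by (simp_all add: ip_def)

lemma ip_sum_left: "iprod (\<Sum>i\<in>I. f i) r = (\<Sum>i\<in>I. iprod (f i) r)"
  by (simp add: ip_def sum_distrib_right F_sum)

lemma ip_sum_right: "iprod r (\<Sum>i\<in>I. f i) = (\<Sum>i\<in>I. iprod r (f i))"
  by (simp add: ip_def sum_distrib_left F_sum ldagger.hom_sum)

lemma ip_mono_mono: "iprod (mono_zw a * p) (mono_zw a * q) = iprod p q"
proof -
  have "mono_zw a * p * (mono_zw (- a) * ldagger q) = (mono_zw a * mono_zw (- a)) * (p * ldagger q)"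
    by (simp only: ac_simps)
  then show ?thesis by (simp add: ip_def ldagger_mult mono_mult_mono)
qed

text \<open>The monomial factors cancel and the two daggers trade places. Reversal is thus
  antiunitary, whence the exchanged arguments.\<close>

lemma ip_lrev_lrev: "iprod (lrev a p) (lrev a q) = iprod q p"
  unfolding lrev_def ip_mono_mono by (simp add: ip_def mult.commute)

lemma ip_pos: "p \<in> lspan ({0..N} \<times> {0..M}) \<Longrightarrow> p \<noteq> 0 \<Longrightarrow> 0 < iprod p p"
  using F_pos[of p] by (simp add: ip_def Poly_space_def)

lemma ip_self_zeroD:
  assumes "p \<in> lspan S" "S \<subseteq> {0..N} \<times> {0..M}" "iprod p p = 0"
  shows "p = 0"
  using ip_pos[of p] assms lspan_mono[OF assms(2)] by force

section \<open>Gram-Schmidt orthogonalization and the orthonormal polynomials\<close>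

lemma ip_lspan_eq_0:
  assumes "\<And>s. s \<in> S \<Longrightarrow> iprod u (mono_zw s) = 0" "q \<in> lspan S"
  shows "iprod u q = 0"
  using assms(2)
proof (induction rule: laurent.span_induct)
  case base
  show "laurent.subspace {q. iprod u q = 0}"
    unfolding laurent.subspace_def
    by (auto simp: lconst_mult_conv_lscale[symmetric] ip_add_right ip_lconst_right)
qed (use assms(1) in auto)

text \<open>One Gram-Schmidt step per monomial: the new monomial is made orthogonal to the old ones,
  giving \<open>b'\<close>, and \<open>y\<close> is corrected by the component of
  \<open>x - y\<close> along \<open>b'\<close>. The induction hypothesis is applied both to
  \<open>x\<close> and to the new monomial, so \<open>x\<close> is kept arbitrary.\<close>

lemma projection_exists:
  assumes "finite S" "S \<subseteq> {0..N} \<times> {0..M}"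
  shows "\<exists>y\<in>lspan S. \<forall>s\<in>S. iprod (x - y) (mono_zw s) = 0"
  using assms
proof (induction S arbitrary: x)
  case empty
  show ?case by (rule bexI[of _ 0]) (simp_all add: laurent.span_zero)
next
  case (insert b S)
  obtain y where y: "y \<in> lspan S" "\<And>s. s \<in> S \<Longrightarrow> iprod (x - y) (mono_zw s) = 0"
    using insert by (metis insert_subset)
  obtain v where v: "v \<in> lspan S" "\<And>s. s \<in> S \<Longrightarrow> iprod (mono_zw b - v) (mono_zw s) = 0"
    using insert by (metis insert_subset)
  define b' where "b' = mono_zw b - v"
  have sub: "lspan S \<subseteq> lspan (insert b S)" by (intro lspan_mono) auto
  have b': "b' \<in> lspan (insert b S)"
    unfolding b'_def by (rule laurent.span_diff[OF laurent.span_base subsetD[OF sub v(1)]]) simp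
  \<comment> \<open>The projection \<open>v\<close> does not involve the monomial at
    \<open>b\<close>, so nothing cancels it; positivity then allows division by the norm of
    \<open>b'\<close>.\<close>
  have "Poly_Mapping.lookup b' b = 1"
    using lspan_lookup_eq_0[OF v(1) insert.hyps(2)] by (simp add: b'_def lookup_minus lookup_mono)
  then have "b' \<noteq> 0" by auto
  then have nz: "iprod b' b' \<noteq> 0"
    using ip_self_zeroD[OF b' insert.prems] by blast
  define c where "c = iprod (x - y) b' / iprod b' b'"
  define d where "d = x - (y + lconst c * b')"
  have d_eq: "iprod d r = iprod (x - y) r - c * iprod b' r" for r
    by (simp add: d_def ip_diff_left ip_add_left ip_lconst_left)
  have dS: "iprod d (mono_zw s) = 0" if "s \<in> S" for s
    using that y(2) v(2) unfolding d_eq b'_def by simp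
  have "iprod d b' = 0" using nz unfolding d_eq c_def by simp
  moreover have "iprod d v = 0" using dS v(1) by (rule ip_lspan_eq_0)
  ultimately have "iprod d (mono_zw b) = 0" by (simp add: b'_def ip_diff_right)
  with dS have "\<forall>s\<in>insert b S. iprod d (mono_zw s) = 0" by auto
  moreover have "y + lconst c * b' \<in> lspan (insert b S)"
    using y(1) sub b' by (intro laurent.span_add lspan_lconst_mult) auto
  ultimately show ?case unfolding d_def by blast
qed

text \<open>Justifies the definite description in \<open>ortho_poly\<close>. For existence, the
  monomial at \<open>t\<close> minus its projection onto the others is normalized; for uniqueness,
  two candidates are proportional by a positive number of modulus one.\<close>

lemma ortho_poly_ex1:
  assumes fin: "finite S" and S: "S \<subseteq> {0..N} \<times> {0..M}" and t: "t \<in> S"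
  shows "\<exists>!p. p \<in> lspan S \<and> 0 < Poly_Mapping.lookup p t \<and>
      iprod p p = 1 \<and> (\<forall>s\<in>S - {t}. iprod p (mono_zw s) = 0)"
    (is "\<exists>!p. ?P p")
proof (rule ex_ex1I)
  obtain y where y: "y \<in> lspan (S - {t})" "\<And>s. s \<in> S - {t} \<Longrightarrow> iprod (mono_zw t - y) (mono_zw s) = 0"
    using projection_exists[of "S - {t}" "mono_zw t"] fin S by blast
  define u where "u = mono_zw t - y"
  have sub: "lspan (S - {t}) \<subseteq> lspan S" by (intro lspan_mono) auto
  have u: "u \<in> lspan S"
    unfolding u_def using t
    by (intro laurent.span_diff[OF laurent.span_base subsetD[OF sub y(1)]] imageI)
  have u_t: "Poly_Mapping.lookup u t = 1"
    using lspan_lookup_eq_0[OF y(1), of t] by (simp add: u_def lookup_minus lookup_mono)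
  then have "u \<noteq> 0" by auto
  then have pos: "0 < iprod u u" using ip_pos u lspan_mono[OF S] by blast
  define r where "r = Re (iprod u u)"
  have r: "iprod u u = of_real r" "r > 0"
    using pos by (auto simp: r_def less_complex_def complex_eq_iff)
  define c where "c = 1 / sqrt r"
  have c: "c > 0" "c * c * r = 1" using r(2) by (auto simp: c_def)
  have "iprod (lconst c * u) (lconst c * u) = of_real (c * c * r)"
    by (simp add: ip_lconst_left ip_lconst_right r)
  then have "iprod (lconst c * u) (lconst c * u) = 1" unfolding c by simp
  moreover have "0 < Poly_Mapping.lookup (lconst c * u) t"
    using c(1) by (simp add: less_complex_def u_t)
  moreover have "iprod (lconst c * u) (mono_zw s) = 0" if "s \<in> S - {t}" for s
    using y(2)[OF that] unfolding ip_lconst_left u_def by simp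
  ultimately have "?P (lconst c * u)" using lspan_lconst_mult[OF u] by blast
  then show "\<exists>p. ?P p" ..
next
  fix p q assume p: "?P p" and q: "?P q"
  \<comment> \<open>This ratio cancels the coefficient at \<open>t\<close> in
    \<open>p - lconst c * q\<close>, which therefore lies in the span of the other monomials and is
    orthogonal to it, hence to itself.\<close>
  define c where "c = Poly_Mapping.lookup p t / Poly_Mapping.lookup q t"
  have pt: "0 < Poly_Mapping.lookup p t" and qt: "0 < Poly_Mapping.lookup q t" using p q by auto
  obtain a where a: "Poly_Mapping.lookup p t = of_real a" "a > 0"
    using pt by (auto simp: less_complex_def complex_eq_iff intro: that[of "Re _"])
  obtain b where b: "Poly_Mapping.lookup q t = of_real b" "b > 0"
    using qt by (auto simp: less_complex_def complex_eq_iff intro: that[of "Re _"])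
  have c: "c = of_real (a / b)" by (simp add: c_def a b)
  define d where "d = p - lconst c * q"
  have dS: "d \<in> lspan S" unfolding d_def using p q by (intro laurent.span_diff lspan_lconst_mult) auto
  moreover have "Poly_Mapping.lookup d t = 0"
    using b by (simp add: d_def lookup_minus c_def)
  ultimately have "d \<in> lspan (S - {t})"
    using lspan_lead[of d t "S - {t}"] by (simp only: insert_Diff[OF t])
  moreover have "iprod d (mono_zw s) = 0" if "s \<in> S - {t}" for s
    using p q that by (simp add: d_def ip_diff_left ip_lconst_left)
  ultimately have "iprod d d = 0" using ip_lspan_eq_0[of "S - {t}" d d] by blast
  then have "d = 0" using ip_self_zeroD[OF dS S] by blast
  then have pq: "p = lconst c * q" by (simp add: d_def)
  have "iprod p p = c * cnj c * iprod q q" unfolding pq by (simp add: ip_lconst_left ip_lconst_right)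
  then have "c * cnj c = 1" using p q by simp
  then have "(a / b)\<^sup>2 = 1"
    unfolding c by (metis complex_cnj_complex_of_real of_real_1 of_real_eq_iff of_real_mult power2_eq_square)
  moreover have "a / b > 0" using a b by simp
  ultimately have "a / b = 1" unfolding power2_eq_1_iff by linarith
  then show "p = q" using pq c by simp
qed

lemma ortho_poly:
  assumes "finite S" "S \<subseteq> {0..N} \<times> {0..M}" "t \<in> S"
  shows ortho_poly_lspan: "ortho_poly F S t \<in> lspan S"
    and ortho_poly_lookup: "0 < Poly_Mapping.lookup (ortho_poly F S t) t"
    and ortho_poly_norm: "iprod (ortho_poly F S t) (ortho_poly F S t) = 1"
    and ortho_poly_ortho: "\<And>q. q \<in> lspan (S - {t}) \<Longrightarrow> iprod (ortho_poly F S t) q = 0"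
proof -
  note * = theI'[OF ortho_poly_ex1[OF assms], folded ortho_poly_def]
  show "ortho_poly F S t \<in> lspan S" using * by (rule conjunct1)
  show "0 < Poly_Mapping.lookup (ortho_poly F S t) t"
    using *[THEN conjunct2] by (rule conjunct1)
  show "iprod (ortho_poly F S t) (ortho_poly F S t) = 1"
    using *[THEN conjunct2, THEN conjunct2] by (rule conjunct1)
  show "iprod (ortho_poly F S t) q = 0" if "q \<in> lspan (S - {t})" for q
    using bspec[OF *[THEN conjunct2, THEN conjunct2, THEN conjunct2]] that by (rule ip_lspan_eq_0)
qed

text \<open>Subtracting the multiple of \<open>ortho_poly F S t\<close> with the same coefficient at
  \<open>t\<close> leaves an element orthogonal to \<open>ortho_poly F S t\<close>. The quotient
  formula later yields entries of \<open>coeffA\<close>, the second claim is one step of an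
  orthogonal expansion.\<close>

lemma ip_ortho_poly:
  assumes S: "finite S" "S \<subseteq> {0..N} \<times> {0..M}" "t \<in> S" and x: "x \<in> lspan S"
  shows "iprod x (ortho_poly F S t) = Poly_Mapping.lookup x t / Poly_Mapping.lookup (ortho_poly F S t) t"
    and "x - lconst (iprod x (ortho_poly F S t)) * ortho_poly F S t \<in> lspan (S - {t})"
proof -
  let ?e = "ortho_poly F S t"
  note e = ortho_poly[OF S]
  define c where "c = Poly_Mapping.lookup x t / Poly_Mapping.lookup ?e t"
  have "x - lconst c * ?e \<in> lspan (insert t (S - {t}))"
    unfolding insert_Diff[OF S(3)] using x e(1) by (intro laurent.span_diff lspan_lconst_mult)
  moreover have "Poly_Mapping.lookup (x - lconst c * ?e) t = 0"
    using order_less_imp_not_eq[OF e(2)] by (simp add: lookup_minus c_def)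
  ultimately have mem: "x - lconst c * ?e \<in> lspan (S - {t})" by (rule lspan_lead)
  have "iprod (x - lconst c * ?e) ?e = 0"
    using e(4)[OF mem] by (metis ip_cnj complex_cnj_zero)
  then have c: "iprod x ?e = c" using e(3) unfolding ip_diff_left ip_lconst_left by simp
  show "iprod x ?e = Poly_Mapping.lookup x t / Poly_Mapping.lookup ?e t" unfolding c c_def ..
  show "x - lconst (iprod x ?e) * ?e \<in> lspan (S - {t})" unfolding c by (rule mem)
qed

text \<open>
  Both \<open>Phi\<close> and \<open>tPhi\<close> arise from adjoining the monomials \<open>t 0\<close>, \<open>t 1\<close>, \<open>\<dots>\<close> of one line to a rectangle \<open>B\<close>.
\<close>

context
  fixes B :: "(int \<times> int) set" and t :: "nat \<Rightarrow> int \<times> int" and k :: nat and e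
  assumes fin: "finite B" and box: "B \<union> t ` {..<k} \<subseteq> {0..N} \<times> {0..M}"
    and inj: "inj t" and disj: "\<And>l. t l \<notin> B"
    and e: "\<And>l. l < k \<Longrightarrow> e l = ortho_poly F (B \<union> t ` {..l}) (t l)"
begin

lemma chain_diff: "B \<union> t ` {..l} - {t l} = B \<union> t ` {..<l}"
  using inj disj by (auto simp: inj_def order_less_le)

lemma chain:
  assumes l: "l < k"
  shows chain_lspan: "e l \<in> lspan (B \<union> t ` {..l})"
    and chain_ortho: "q \<in> lspan (B \<union> t ` {..<l}) \<Longrightarrow> iprod (e l) q = 0"
    and chain_norm: "iprod (e l) (e l) = 1"
    and chain_step: "x \<in> lspan (B \<union> t ` {..l}) \<Longrightarrow> x - lconst (iprod x (e l)) * e l \<in> lspan (B \<union> t ` {..<l})"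
proof -
  have S: "finite (B \<union> t ` {..l})" "B \<union> t ` {..l} \<subseteq> {0..N} \<times> {0..M}" "t l \<in> B \<union> t ` {..l}"
    using fin l by (auto intro!: subset_trans[OF _ box])
  note * = ortho_poly[OF S, folded e[OF l], unfolded chain_diff]
  show "e l \<in> lspan (B \<union> t ` {..l})" "iprod (e l) (e l) = 1" by (fact *)+
  show "q \<in> lspan (B \<union> t ` {..<l}) \<Longrightarrow> iprod (e l) q = 0" by (fact *)
  show "x \<in> lspan (B \<union> t ` {..l}) \<Longrightarrow> x - lconst (iprod x (e l)) * e l \<in> lspan (B \<union> t ` {..<l})"
    using ip_ortho_poly(2)[OF S, folded e[OF l], unfolded chain_diff] .
qed

lemma chain_orthonormal:
  assumes "i < k" "j < k"
  shows "iprod (e i) (e j) = (if i = j then 1 else 0)"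
proof -
  have lt: "iprod (e i) (e j) = 0" if "j < i" "i < k" for i j
  proof -
    have "B \<union> t ` {..j} \<subseteq> B \<union> t ` {..<i}" using that by auto
    from lspan_mono[OF this] have "e j \<in> lspan (B \<union> t ` {..<i})"
      using chain_lspan[of j] that by auto
    with that(2) show ?thesis by (rule chain_ortho)
  qed
  show ?thesis
  proof (cases i j rule: linorder_cases)
    case less
    then show ?thesis using lt[of i j] assms ip_cnj[of "e j" "e i"] by simp
  next
    case equal
    then show ?thesis using chain_norm[of i] assms by simp
  next
    case greater
    then show ?thesis using lt[of j i] assms by simp
  qed
qed

text \<open>The component along the last \<open>e l\<close> is split off first. The remainder lies
  one stage lower and, by orthonormality, has the same inner products with the earlier
  \<open>e i\<close>.\<close>

lemma chain_expand:
  assumes "l \<le> k" "x \<in> lspan (B \<union> t ` {..<l})"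
  shows "x - (\<Sum>i<l. lconst (iprod x (e i)) * e i) \<in> lspan B"
  using assms
proof (induction l arbitrary: x)
  case (Suc l)
  let ?y = "x - lconst (iprod x (e l)) * e l"
  have "?y - (\<Sum>i<l. lconst (iprod ?y (e i)) * e i) \<in> lspan B"
  proof (rule Suc.IH)
    show "l \<le> k" using Suc.prems by simp
    show "?y \<in> lspan (B \<union> t ` {..<l})"
      using chain_step[of l x] Suc.prems by (simp only: lessThan_Suc_atMost Suc_le_eq)
  qed
  moreover have "iprod ?y (e i) = iprod x (e i)" if "i < l" for i
    using that Suc.prems chain_orthonormal[of l i] by (simp add: ip_diff_left ip_lconst_left)
  then have "(\<Sum>i<l. lconst (iprod ?y (e i)) * e i) = (\<Sum>i<l. lconst (iprod x (e i)) * e i)"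
    by (intro sum.cong) auto
  ultimately show ?case by (simp add: diff_diff_eq add.commute)
qed simp

end

end

subsection \<open>Columns of Laurent polynomials\<close>

abbreviation cmat :: "complex mat \<Rightarrow> laurent mat" where
  "cmat C \<equiv> map_mat lconst C"

abbreviation mrev :: "int \<times> int \<Rightarrow> laurent mat \<Rightarrow> laurent mat" where
  "mrev a X \<equiv> map_mat (lrev a) X"

lemma mat_adjoint_dim [simp]:
  "dim_row (mat_adjoint A) = dim_col A" "dim_col (mat_adjoint A) = dim_row A"
  by (simp_all add: mat_adjoint_def)

lemma mat_adjoint_carrier [simp]: "A \<in> carrier_mat a b \<Longrightarrow> mat_adjoint A \<in> carrier_mat b a"
  unfolding carrier_mat_def by simp

lemma mat_adjoint_index [simp]:
  "i < dim_col A \<Longrightarrow> j < dim_row A \<Longrightarrow> mat_adjoint A $$ (i, j) = conjugate (A $$ (j, i))"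
  by (simp add: mat_adjoint_def mat_of_rows_index)

lemma mat_adjoint_zero [simp]: "mat_adjoint (0\<^sub>m a b :: complex mat) = 0\<^sub>m b a"
  by (intro eq_matI) auto

lemma index_cmat_mult:
  assumes "C \<in> carrier_mat c a" "X \<in> carrier_mat a 1" "i < c"
  shows "(cmat C * X) $$ (i, 0) = (\<Sum>j<a. lconst (C $$ (i, j)) * X $$ (j, 0))"
  using assms by (auto simp: scalar_prod_def atLeast0LessThan intro!: sum.cong)

lemma lrev_diff: "lrev a (p - q) = lrev a p - lrev a q"
  by (simp add: lrev_def ldagger.hom_minus right_diff_distrib)

lemma mrev_diff:
  assumes "X \<in> carrier_mat a b" "Y \<in> carrier_mat a b"
  shows "mrev k (X - Y) = mrev k X - mrev k Y"
  using assms by (intro eq_matI) (auto simp: lrev_diff)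

lemma lrev_lconst_mult: "lrev a (lconst c * p) = lconst (cnj c) * lrev a p"
  by (simp add: lrev_def ldagger_mult mult.left_commute)

lemma lrev_sum: "lrev a (sum f I) = (\<Sum>i\<in>I. lrev a (f i))"
  by (simp add: lrev_def ldagger.hom_sum sum_distrib_left)

text \<open>Reversal is conjugate linear, so it conjugates the constant factor.\<close>

lemma mrev_cmat_mult:
  assumes "C \<in> carrier_mat c a" "X \<in> carrier_mat a 1"
  shows "mrev k (cmat C * X) = cmat (map_mat cnj C) * mrev k X"
proof (rule eq_matI)
  fix i j assume "i < dim_row (cmat (map_mat cnj C) * mrev k X)" "j < dim_col (cmat (map_mat cnj C) * mrev k X)"
  then have ij: "i < c" "j = 0" using assms by auto
  have "mrev k (cmat C * X) $$ (i, 0) = lrev k ((cmat C * X) $$ (i, 0))"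
    using assms ij by (intro index_map_mat) auto
  also have "\<dots> = (\<Sum>l<a. lconst (map_mat cnj C $$ (i, l)) * mrev k X $$ (l, 0))"
    unfolding index_cmat_mult[OF assms ij(1)] lrev_sum
    using assms ij by (intro sum.cong) (auto simp: lrev_lconst_mult)
  also have "\<dots> = (cmat (map_mat cnj C) * mrev k X) $$ (i, 0)"
    using assms ij by (intro index_cmat_mult[symmetric]) auto
  finally show "mrev k (cmat C * X) $$ (i, j) = (cmat (map_mat cnj C) * mrev k X) $$ (i, j)"
    unfolding ij .
qed (use assms in auto)

section \<open>Columns with entries in a span of monomials\<close>

definition col_on :: "(int \<times> int) set \<Rightarrow> laurent mat \<Rightarrow> bool" where
  "col_on S X \<longleftrightarrow> (\<forall>i<dim_row X. X $$ (i, 0) \<in> lspan S)"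

lemma col_on_mono: "col_on S X \<Longrightarrow> S \<subseteq> T \<Longrightarrow> col_on T X"
  using lspan_mono unfolding col_on_def by blast

lemma col_on_diff:
  assumes "X \<in> carrier_mat a 1" "Y \<in> carrier_mat a 1" "col_on S X" "col_on S Y"
  shows "col_on S (X - Y)"
  using assms by (auto simp: col_on_def laurent.span_diff)

lemma col_on_cmat_mult:
  assumes "C \<in> carrier_mat c a" "X \<in> carrier_mat a 1" "col_on S X"
  shows "col_on S (cmat C * X)"
  unfolding col_on_def
proof (intro allI impI)
  fix i assume "i < dim_row (cmat C * X)"
  then have i: "i < c" using assms by simp
  show "(cmat C * X) $$ (i, 0) \<in> lspan S"
    unfolding index_cmat_mult[OF assms(1,2) i]
    using assms by (intro laurent.span_sum lspan_lconst_mult) (auto simp: col_on_def)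
qed

lemma col_on_mrev:
  assumes "X \<in> carrier_mat a 1" "col_on S X" "\<And>k. k \<in> S \<Longrightarrow> b - k \<in> T"
  shows "col_on T (mrev b X)"
  unfolding col_on_def
proof (intro allI impI)
  fix i assume "i < dim_row (mrev b X)"
  then have "mrev b X $$ (i, 0) = lrev b (X $$ (i, 0))" "X $$ (i, 0) \<in> lspan S"
    using assms(1,2) by (auto simp: col_on_def)
  then show "mrev b X $$ (i, 0) \<in> lspan T" using lrev_lspan[OF _ assms(3)] by auto
qed

lemma mono_mult_lspan:
  assumes "p \<in> lspan S" "\<And>k. k \<in> S \<Longrightarrow> k + b \<in> T"
  shows "mono_zw b * p \<in> lspan T"
  unfolding lspan_iff_lookup lookup_mono_mult
proof (intro allI impI)
  fix k assume "k \<notin> T"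
  then have "k - b \<notin> S" using assms(2)[of "k - b"] by auto
  then show "Poly_Mapping.lookup p (k - b) = 0" by (rule lspan_lookup_eq_0[OF assms(1)])
qed

lemma col_on_smult:
  assumes "X \<in> carrier_mat a 1" "col_on S X" "\<And>k. k \<in> S \<Longrightarrow> k + b \<in> T"
  shows "col_on T (mono_zw b \<cdot>\<^sub>m X)"
  unfolding col_on_def
proof (intro allI impI)
  fix i assume "i < dim_row (mono_zw b \<cdot>\<^sub>m X)"
  then have "(mono_zw b \<cdot>\<^sub>m X) $$ (i, 0) = mono_zw b * X $$ (i, 0)" "X $$ (i, 0) \<in> lspan S"
    using assms(1,2) by (auto simp: col_on_def)
  then show "(mono_zw b \<cdot>\<^sub>m X) $$ (i, 0) \<in> lspan T" using mono_mult_lspan[OF _ assms(3)] by auto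
qed

section \<open>Matrices of inner products of columns\<close>

lemma mat_ldagger_carrier [simp]: "X \<in> carrier_mat a b \<Longrightarrow> mat_ldagger X \<in> carrier_mat b a"
  by (simp add: mat_ldagger_def)

lemma ip_mat_dim [simp]:
  "dim_row (ip_mat f X Y) = dim_row X" "dim_col (ip_mat f X Y) = dim_row Y"
  by (simp_all add: ip_mat_def mat_ldagger_def)

lemma ip_mat_carrier [simp]:
  "X \<in> carrier_mat a 1 \<Longrightarrow> Y \<in> carrier_mat b 1 \<Longrightarrow> ip_mat f X Y \<in> carrier_mat a b"
  by (auto simp: ip_mat_def mat_ldagger_def)

lemma ip_mat_index:
  assumes "X \<in> carrier_mat a 1" "Y \<in> carrier_mat b 1" "i < a" "j < b"
  shows "ip_mat f X Y $$ (i, j) = ip f (X $$ (i, 0)) (Y $$ (j, 0))"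
  using assms by (simp add: ip_mat_def mat_ldagger_def ip_def scalar_prod_def)

lemma mat_eq_ip_mat_index:
  assumes "X \<in> carrier_mat a 1" "Y \<in> carrier_mat b 1" "C \<in> carrier_mat a b"
    and "\<And>i j. i < a \<Longrightarrow> j < b \<Longrightarrow> ip f (X $$ (i, 0)) (Y $$ (j, 0)) = C $$ (i, j)"
  shows "ip_mat f X Y = C"
  using assms ip_mat_carrier[OF assms(1,2), of f] by (intro eq_matI) (auto simp: ip_mat_index)

lemma int_image_atMost: "int ` {..l} = {0..int l}"
  unfolding atLeast0AtMost[symmetric] image_int_atLeastAtMost by simp

lemma int_image_lessThan_nat: "int ` {..<nat (m + 1)} = {0..m}"
  unfolding atLeast0LessThan[symmetric] image_int_atLeastLessThan by auto

context pd_functional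
begin

lemma ip_mat_cmat_left:
  assumes "C \<in> carrier_mat c a" "X \<in> carrier_mat a 1" "Y \<in> carrier_mat b 1"
  shows "ip_mat F (cmat C * X) Y = C * ip_mat F X Y"
proof (rule mat_eq_ip_mat_index[of _ c _ b])
  fix i j assume ij: "i < c" "j < b"
  have "iprod ((cmat C * X) $$ (i, 0)) (Y $$ (j, 0)) = (\<Sum>l<a. C $$ (i, l) * ip_mat F X Y $$ (l, j))"
    unfolding index_cmat_mult[OF assms(1,2) ij(1)] ip_sum_left ip_lconst_left
    using assms ij by (intro sum.cong) (auto simp: ip_mat_index)
  also have "\<dots> = (C * ip_mat F X Y) $$ (i, j)"
    using assms ij by (auto simp: scalar_prod_def atLeast0LessThan intro!: sum.cong)
  finally show "iprod ((cmat C * X) $$ (i, 0)) (Y $$ (j, 0)) = (C * ip_mat F X Y) $$ (i, j)" .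
qed (use assms in \<open>auto intro!: carrier_matI\<close>)

lemma ip_mat_adjoint:
  assumes "X \<in> carrier_mat a 1" "Y \<in> carrier_mat b 1"
  shows "mat_adjoint (ip_mat F X Y) = ip_mat F Y X"
  using assms by (intro mat_eq_ip_mat_index[of _ b _ a, symmetric]) (auto simp: ip_mat_index ip_cnj)

lemma ip_mat_diff_left:
  assumes "X \<in> carrier_mat a 1" "Y \<in> carrier_mat a 1" "Z \<in> carrier_mat b 1"
  shows "ip_mat F (X - Y) Z = ip_mat F X Z - ip_mat F Y Z"
  using assms by (intro mat_eq_ip_mat_index[of _ a _ b]) (auto simp: ip_mat_index ip_diff_left minus_carrier_mat)

lemma ip_mat_diff_right:
  assumes "X \<in> carrier_mat a 1" "Y \<in> carrier_mat a 1" "Z \<in> carrier_mat b 1"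
  shows "ip_mat F Z (X - Y) = ip_mat F Z X - ip_mat F Z Y"
  using assms by (intro mat_eq_ip_mat_index[of _ b _ a]) (auto simp: ip_mat_index ip_diff_right minus_carrier_mat)

lemma ip_mat_cmat_right:
  assumes "C \<in> carrier_mat c a" "X \<in> carrier_mat a 1" "Y \<in> carrier_mat b 1"
  shows "ip_mat F Y (cmat C * X) = ip_mat F Y X * mat_adjoint C"
proof (rule mat_eq_ip_mat_index[of _ b _ c])
  fix i j assume ij: "i < b" "j < c"
  have "iprod (Y $$ (i, 0)) ((cmat C * X) $$ (j, 0)) = (\<Sum>l<a. ip_mat F Y X $$ (i, l) * cnj (C $$ (j, l)))"
    unfolding index_cmat_mult[OF assms(1,2) ij(2)] ip_sum_right ip_lconst_right
    using assms ij by (intro sum.cong) (auto simp: ip_mat_index)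
  also have "\<dots> = (ip_mat F Y X * mat_adjoint C) $$ (i, j)"
    using assms ij by (auto simp: scalar_prod_def atLeast0LessThan intro!: sum.cong)
  finally show "iprod (Y $$ (i, 0)) ((cmat C * X) $$ (j, 0)) = (ip_mat F Y X * mat_adjoint C) $$ (i, j)" .
qed (use assms in \<open>auto intro!: carrier_matI\<close>)

lemma ip_mat_mrev:
  assumes "X \<in> carrier_mat a 1" "Y \<in> carrier_mat b 1"
  shows "ip_mat F (mrev k X) (mrev k Y) = map_mat cnj (ip_mat F X Y)"
  using assms by (intro mat_eq_ip_mat_index[of _ a _ b]) (auto simp: ip_mat_index ip_lrev_lrev ip_cnj)

lemma ip_mat_smult_mono:
  assumes "X \<in> carrier_mat a 1" "Y \<in> carrier_mat b 1"
  shows "ip_mat F (mono_zw k \<cdot>\<^sub>m X) (mono_zw k \<cdot>\<^sub>m Y) = ip_mat F X Y"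
  using assms by (intro mat_eq_ip_mat_index[of _ a _ b]) (auto simp: ip_mat_index ip_mono_mono)

section \<open>Orthogonality of columns to spans, and orthonormal bases\<close>

definition perp :: "laurent mat \<Rightarrow> (int \<times> int) set \<Rightarrow> bool" where
  "perp X S \<longleftrightarrow> (\<forall>i<dim_row X. \<forall>q\<in>lspan S. iprod (X $$ (i, 0)) q = 0)"

lemma perp_mono: "perp X S \<Longrightarrow> T \<subseteq> S \<Longrightarrow> perp X T"
  using lspan_mono unfolding perp_def by blast

lemma perp_diff:
  assumes "X \<in> carrier_mat a 1" "Y \<in> carrier_mat a 1" "perp X S" "perp Y S"
  shows "perp (X - Y) S"
  using assms by (auto simp: perp_def ip_diff_left)

lemma perp_cmat_mult:
  assumes "C \<in> carrier_mat c a" "X \<in> carrier_mat a 1" "perp X S"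
  shows "perp (cmat C * X) S"
  unfolding perp_def
proof (intro allI impI ballI)
  fix i q assume "i < dim_row (cmat C * X)" and q: "q \<in> lspan S"
  then have i: "i < c" using assms by simp
  show "iprod ((cmat C * X) $$ (i, 0)) q = 0"
    unfolding index_cmat_mult[OF assms(1,2) i] ip_sum_left ip_lconst_left
    using assms q by (intro sum.neutral) (auto simp: perp_def)
qed

lemma ip_mat_perp:
  assumes "X \<in> carrier_mat a 1" "Y \<in> carrier_mat b 1" "perp X S" "col_on S Y"
  shows ip_mat_perp_left: "ip_mat F X Y = 0\<^sub>m a b" and ip_mat_perp_right: "ip_mat F Y X = 0\<^sub>m b a"
proof -
  show *: "ip_mat F X Y = 0\<^sub>m a b"
    using assms by (intro mat_eq_ip_mat_index[of _ a _ b]) (auto simp: perp_def col_on_def)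
  show "ip_mat F Y X = 0\<^sub>m b a"
    using ip_mat_adjoint[OF assms(1,2)] unfolding * by simp
qed

text \<open>Because reversal is an antiunitary involution, pairing a reversed entry with
  \<open>q\<close> is the conjugate of pairing the entry with the reversal of
  \<open>q\<close>.\<close>

lemma perp_mrev:
  assumes "X \<in> carrier_mat a 1" "perp X S" "\<And>k. k \<in> T \<Longrightarrow> b - k \<in> S"
  shows "perp (mrev b X) T"
  unfolding perp_def
proof (intro allI impI ballI)
  fix i q assume i: "i < dim_row (mrev b X)" and q: "q \<in> lspan T"
  have "iprod (lrev b (X $$ (i, 0))) (lrev b (lrev b q)) = cnj (iprod (X $$ (i, 0)) (lrev b q))"
    by (simp only: ip_lrev_lrev ip_cnj)
  also have "iprod (X $$ (i, 0)) (lrev b q) = 0"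
    using assms i lrev_lspan[OF q assms(3)] by (auto simp: perp_def)
  finally show "iprod (mrev b X $$ (i, 0)) q = 0" using i assms(1) by simp
qed

lemma perp_smult_mono:
  assumes "X \<in> carrier_mat a 1" "perp X S" "\<And>k. k \<in> T \<Longrightarrow> k - b \<in> S"
  shows "perp (mono_zw b \<cdot>\<^sub>m X) T"
  unfolding perp_def
proof (intro allI impI ballI)
  fix i q assume i: "i < dim_row (mono_zw b \<cdot>\<^sub>m X)" and q: "q \<in> lspan T"
  have mem: "mono_zw (- b) * q \<in> lspan S" using mono_mult_lspan[OF q, of "- b" S] assms(3) by simp
  have "q = mono_zw b * (mono_zw (- b) * q)" by (simp add: mult.assoc[symmetric] mono_mult_mono)
  then have "iprod (mono_zw b * X $$ (i, 0)) q = iprod (X $$ (i, 0)) (mono_zw (- b) * q)"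
    by (metis ip_mono_mono)
  also have "\<dots> = 0" using assms(2) i mem by (auto simp: perp_def)
  finally show "iprod ((mono_zw b \<cdot>\<^sub>m X) $$ (i, 0)) q = 0" using i assms(1) by simp
qed

text \<open>
  The column \<open>X\<close> lists an orthonormal basis of the orthogonal complement of \<open>lspan B\<close> in \<open>lspan S\<close>;
  completeness is stated modulo \<open>lspan B\<close>, which avoids the projection onto \<open>lspan B\<close>.
\<close>

definition onb :: "(int \<times> int) set \<Rightarrow> (int \<times> int) set \<Rightarrow> nat \<Rightarrow> laurent mat \<Rightarrow> bool" where
  "onb B S k X \<longleftrightarrow> X \<in> carrier_mat k 1 \<and> col_on S X \<and> perp X B \<and> ip_mat F X X = 1\<^sub>m k \<and>
     (\<forall>x\<in>lspan S. x - (\<Sum>i<k. lconst (iprod x (X $$ (i, 0))) * X $$ (i, 0)) \<in> lspan B)"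

lemma onbD:
  assumes "onb B S k X"
  shows "X \<in> carrier_mat k 1" "col_on S X" "perp X B" "ip_mat F X X = 1\<^sub>m k"
  using assms by (auto simp: onb_def)

lemma onb_expand:
  assumes X: "onb B S k X" and Y: "Y \<in> carrier_mat a 1" "col_on S Y"
  shows "col_on B (Y - cmat (ip_mat F Y X) * X)"
  unfolding col_on_def
proof (intro allI impI)
  fix i assume "i < dim_row (Y - cmat (ip_mat F Y X) * X)"
  then have i: "i < a" using Y ip_mat_carrier[OF Y(1) onbD(1)[OF X], of F] by auto
  have "(cmat (ip_mat F Y X) * X) $$ (i, 0) =
      (\<Sum>j<k. lconst (iprod (Y $$ (i, 0)) (X $$ (j, 0))) * X $$ (j, 0))"
    unfolding index_cmat_mult[OF ip_mat_carrier[OF Y(1) onbD(1)[OF X]] onbD(1)[OF X] i]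
    using i by (intro sum.cong) (auto simp: ip_mat_index[OF Y(1) onbD(1)[OF X]])
  moreover have "(Y - cmat (ip_mat F Y X) * X) $$ (i, 0) = Y $$ (i, 0) - (cmat (ip_mat F Y X) * X) $$ (i, 0)"
    using i Y ip_mat_carrier[OF Y(1) onbD(1)[OF X], of F] onbD(1)[OF X] by (intro index_minus_mat) auto
  ultimately show "(Y - cmat (ip_mat F Y X) * X) $$ (i, 0) \<in> lspan B"
    using X Y i by (simp add: onb_def col_on_def)
qed

text \<open>Any element of \<open>lspan S\<close> is a combination of the entries of
  \<open>X\<close> plus an element of \<open>lspan B\<close>, and \<open>Y\<close> is orthogonal to
  both.\<close>

lemma onb_complete:
  assumes X: "onb B S k X" and Y: "Y \<in> carrier_mat a 1" "perp Y B" "ip_mat F Y X = 0\<^sub>m a k"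
  shows "perp Y S"
  unfolding perp_def
proof (intro allI impI ballI)
  fix i q assume "i < dim_row Y" and q: "q \<in> lspan S"
  then have i: "i < a" using Y by simp
  define h where "h = q - (\<Sum>j<k. lconst (iprod q (X $$ (j, 0))) * X $$ (j, 0))"
  have "iprod (Y $$ (i, 0)) h = 0" using X Y q i by (auto simp: h_def onb_def perp_def)
  moreover have "iprod (Y $$ (i, 0)) (X $$ (j, 0)) = 0" if "j < k" for j
    using ip_mat_index[OF Y(1) onbD(1)[OF X] i that, of F] Y(3) i that by simp
  ultimately show "iprod (Y $$ (i, 0)) q = 0"
    by (simp add: h_def ip_diff_right ip_sum_right ip_lconst_right)
qed

text \<open>The error of the expansion lies in \<open>lspan B\<close> and is orthogonal to
  \<open>lspan B\<close>, hence has norm zero; positivity, available inside the box, makes it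
  vanish.\<close>

lemma onb_expand_perp:
  assumes X: "onb B S k X" and BS: "B \<subseteq> S" "S \<subseteq> {0..N} \<times> {0..M}"
    and Y: "Y \<in> carrier_mat a 1" "col_on S Y" "perp Y B"
  shows "Y = cmat (ip_mat F Y X) * X"
proof -
  note X' = onbD[OF X]
  note C = ip_mat_carrier[OF Y(1) X'(1), of F]
  define D where "D = Y - cmat (ip_mat F Y X) * X"
  have CX: "cmat (ip_mat F Y X) * X \<in> carrier_mat a 1" using C X'(1) by (intro mult_carrier_mat) auto
  then have D: "D \<in> carrier_mat a 1" unfolding D_def by (rule minus_carrier_mat)
  have on: "col_on B D" unfolding D_def by (rule onb_expand[OF X Y(1,2)])
  have "perp D B"
    unfolding D_def by (rule perp_diff[OF Y(1) CX Y(3) perp_cmat_mult[OF C X'(1,3)]])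
  then have zero: "D $$ (i, 0) = 0" if "i < a" for i
    using on that D BS ip_self_zeroD[of "D $$ (i, 0)" B] by (auto simp: col_on_def perp_def)
  show ?thesis
  proof (rule eq_matI)
    fix i j assume "i < dim_row (cmat (ip_mat F Y X) * X)" "j < dim_col (cmat (ip_mat F Y X) * X)"
    then have ij: "i < a" "j = 0" using CX by auto
    have "D $$ (i, 0) = Y $$ (i, 0) - (cmat (ip_mat F Y X) * X) $$ (i, 0)"
      unfolding D_def using ij CX by (intro index_minus_mat) (auto simp only: carrier_matD)
    then show "Y $$ (i, j) = (cmat (ip_mat F Y X) * X) $$ (i, j)" using zero[OF ij(1)] ij by simp
  qed (use Y CX in auto)
qed

text \<open>The rows run from the last adjoined monomial down to the first, matching the decreasing
  superscripts in \<open>Phi\<close> and \<open>tPhi\<close>.\<close>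

lemma chain_onb:
  assumes fin: "finite B" and box: "B \<union> t ` {..<k} \<subseteq> {0..N} \<times> {0..M}"
    and inj: "inj t" and disj: "\<And>l. t l \<notin> B"
    and e: "\<And>l. l < k \<Longrightarrow> e l = ortho_poly F (B \<union> t ` {..l}) (t l)"
  shows "onb B (B \<union> t ` {..<k}) k (mat k 1 (\<lambda>(r, _). e (k - Suc r)))"
    (is "onb B ?S k ?X")
  unfolding onb_def
proof (intro conjI ballI)
  note ch = chain[OF assms] chain_orthonormal[OF assms] chain_expand[OF assms]
  show X: "?X \<in> carrier_mat k 1" by simp
  show "col_on ?S ?X"
    unfolding col_on_def
  proof (intro allI impI)
    fix i assume "i < dim_row ?X"
    then have i: "i < k" by simp
    have "B \<union> t ` {..k - Suc i} \<subseteq> ?S" using i by auto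
    from lspan_mono[OF this] show "?X $$ (i, 0) \<in> lspan ?S" using ch(1)[of "k - Suc i"] i by auto
  qed
  show "perp ?X B"
    unfolding perp_def
  proof (intro allI impI ballI)
    fix i q assume "i < dim_row ?X" and q: "q \<in> lspan B"
    then have i: "i < k" by simp
    have "lspan B \<subseteq> lspan (B \<union> t ` {..<k - Suc i})" by (rule lspan_mono) auto
    then show "iprod (?X $$ (i, 0)) q = 0" using ch(2)[of "k - Suc i" q] i q by auto
  qed
  show "ip_mat F ?X ?X = 1\<^sub>m k"
  proof (rule mat_eq_ip_mat_index[OF X X one_carrier_mat])
    fix i j assume ij: "i < k" "j < k"
    then have "k - Suc i = k - Suc j \<longleftrightarrow> i = j" by linarith
    then show "iprod (?X $$ (i, 0)) (?X $$ (j, 0)) = 1\<^sub>m k $$ (i, j)"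
      using ij ch(5)[of "k - Suc i" "k - Suc j"] by simp
  qed
  fix x assume x: "x \<in> lspan ?S"
  have "(\<Sum>i<k. lconst (iprod x (?X $$ (i, 0))) * ?X $$ (i, 0)) =
      (\<Sum>i<k. lconst (iprod x (e (k - Suc i))) * e (k - Suc i))"
    by (intro sum.cong) auto
  also have "\<dots> = (\<Sum>i<k. lconst (iprod x (e i)) * e i)"
    by (rule sum.nat_diff_reindex)
  finally show "x - (\<Sum>i<k. lconst (iprod x (?X $$ (i, 0))) * ?X $$ (i, 0)) \<in> lspan B"
    using ch(6)[OF _ order_refl x] by simp
qed

text \<open>The case \<open>m = - 1\<close> is included: the empty column is a basis for empty
  rectangles, as the first relation requires at \<open>m = 0\<close>.\<close>

lemma Phi_onb:
  assumes "0 \<le> n" "n \<le> N" "m \<le> M"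
  shows "onb ({0..<n} \<times> {0..m}) ({0..n} \<times> {0..m}) (nat (m + 1)) (Phi F n m)"
proof -
  define t where "t l = (n, int l)" for l
  have im: "t ` {..l} = {n} \<times> {0..int l}" for l
    unfolding int_image_atMost[symmetric] by (auto simp: t_def)
  have im': "t ` {..<nat (m + 1)} = {n} \<times> {0..m}"
    unfolding int_image_lessThan_nat[symmetric] by (auto simp: t_def)
  have "onb ({0..<n} \<times> {0..m}) ({0..<n} \<times> {0..m} \<union> t ` {..<nat (m + 1)}) (nat (m + 1))
      (mat (nat (m + 1)) 1 (\<lambda>(r, _). phi F n m (int (nat (m + 1) - Suc r))))"
  proof (rule chain_onb[where e = "\<lambda>l. phi F n m (int l)"])
    show "{0..<n} \<times> {0..m} \<union> t ` {..<nat (m + 1)} \<subseteq> {0..N} \<times> {0..M}"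
      unfolding im' using assms by auto
    show "phi F n m (int l) = ortho_poly F ({0..<n} \<times> {0..m} \<union> t ` {..l}) (t l)" for l
      unfolding im phi_def by (simp add: t_def)
  qed (auto simp: t_def inj_def)
  moreover have "{0..<n} \<times> {0..m} \<union> t ` {..<nat (m + 1)} = {0..n} \<times> {0..m}"
    unfolding im' using assms by auto
  moreover have "Phi F n m = mat (nat (m + 1)) 1 (\<lambda>(r, _). phi F n m (int (nat (m + 1) - Suc r)))"
    unfolding Phi_def by (rule cong_mat) (auto simp: of_nat_diff intro!: arg_cong[of _ _ "phi F n m"])
  ultimately show ?thesis by simp
qed

lemma tPhi_onb:
  assumes "0 \<le> m" "n \<le> N" "m \<le> M"
  shows "onb ({0..n} \<times> {0..<m}) ({0..n} \<times> {0..m}) (nat (n + 1)) (tPhi F n m)"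
proof -
  define t where "t l = (int l, m)" for l
  have im: "t ` {..l} = {0..int l} \<times> {m}" for l
    unfolding int_image_atMost[symmetric] by (auto simp: t_def)
  have im': "t ` {..<nat (n + 1)} = {0..n} \<times> {m}"
    unfolding int_image_lessThan_nat[symmetric] by (auto simp: t_def)
  have "onb ({0..n} \<times> {0..<m}) ({0..n} \<times> {0..<m} \<union> t ` {..<nat (n + 1)}) (nat (n + 1))
      (mat (nat (n + 1)) 1 (\<lambda>(r, _). tphi F n m (int (nat (n + 1) - Suc r))))"
  proof (rule chain_onb[where e = "\<lambda>l. tphi F n m (int l)"])
    show "{0..n} \<times> {0..<m} \<union> t ` {..<nat (n + 1)} \<subseteq> {0..N} \<times> {0..M}"
      unfolding im' using assms by auto
    show "tphi F n m (int l) = ortho_poly F ({0..n} \<times> {0..<m} \<union> t ` {..l}) (t l)" for l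
      unfolding im tphi_def by (simp add: t_def)
  qed (auto simp: t_def inj_def)
  moreover have "{0..n} \<times> {0..<m} \<union> t ` {..<nat (n + 1)} = {0..n} \<times> {0..m}"
    unfolding im' using assms by auto
  moreover have "tPhi F n m = mat (nat (n + 1)) 1 (\<lambda>(r, _). tphi F n m (int (nat (n + 1) - Suc r)))"
    unfolding tPhi_def by (rule cong_mat) (auto simp: of_nat_diff intro!: arg_cong[of _ _ "tphi F n m"])
  ultimately show ?thesis by simp
qed

end

subsection \<open>The relations for a globally hermitian functional\<close>

text \<open>With closed intervals, the rectangles attached to neighbouring indices become literally
  equal.\<close>

lemma atLeastLessThan_conv_int: "{a..<b} = {a..b - 1}" for a b :: int
  by auto

interpretation cnj: comm_ring_hom cnj
  by unfold_locales simp_all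

lemma map_cnj_mat_adjoint: "map_mat cnj (mat_adjoint A) = transpose_mat A"
  for A :: "complex mat"
  by (intro eq_matI) auto

lemma transpose_map_cnj: "transpose_mat (map_mat cnj A) = mat_adjoint A"
  for A :: "complex mat"
  by (intro eq_matI) auto

lemma minus_zero_right_mat [simp]: "X \<in> carrier_mat a b \<Longrightarrow> X - 0\<^sub>m a b = X"
  for X :: "'a :: group_add mat"
  by (intro eq_matI) auto

text \<open>A nonzero determinant makes \<open>A\<close> a unit of the matrix ring, which excludes
  the result \<open>None\<close> of \<open>mat_inverse\<close>.\<close>

lemma mat_inv_mult:
  assumes "A \<in> carrier_mat n n" "det A \<noteq> 0"
  shows "mat_inv A \<in> carrier_mat n n" "mat_inv A * A = 1\<^sub>m n"
proof -
  have "A \<in> Units (ring_mat TYPE(complex) n ())"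
    by (rule det_non_zero_imp_unit[OF assms])
  then obtain B where "mat_inverse A = Some B"
    using mat_inverse(1)[OF assms(1), where b = "()"] by fastforce
  then show "mat_inv A \<in> carrier_mat n n" "mat_inv A * A = 1\<^sub>m n"
    using mat_inverse(2)[OF assms(1)] by (auto simp: mat_inv_def)
qed

section \<open>The first relation\<close>

context pd_functional
begin

lemma coeffI_tcoeffG:
  assumes n: "0 \<le> n" "n \<le> N" and m: "0 \<le> m" "m \<le> M"
  shows "coeffI F n m * mat_adjoint (tcoeffG F n m) = - (mat_adjoint (coeffG F n m) * coeffK F n m)"
proof -
  define P where "P = Phi F n m"
  define Q where "Q = Phi F n (m - 1)"
  define T where "T = tPhi F n m"
  define U where "U = tPhi F (n - 1) m"
  define a b c d where "a = nat (m + 1)" and "b = nat m" and "c = nat (n + 1)" and "d = nat n"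
  have P: "onb ({0..n - 1} \<times> {0..m}) ({0..n} \<times> {0..m}) a P"
    using Phi_onb[of n m] assms by (simp add: P_def a_def atLeastLessThan_conv_int)
  have Q: "onb ({0..n - 1} \<times> {0..m - 1}) ({0..n} \<times> {0..m - 1}) b Q"
    using Phi_onb[of n "m - 1"] assms by (simp add: Q_def b_def atLeastLessThan_conv_int)
  have T: "onb ({0..n} \<times> {0..m - 1}) ({0..n} \<times> {0..m}) c T"
    using tPhi_onb[of m n] assms by (simp add: T_def c_def atLeastLessThan_conv_int)
  have U: "onb ({0..n - 1} \<times> {0..m - 1}) ({0..n - 1} \<times> {0..m}) d U"
    using tPhi_onb[of m "n - 1"] assms by (simp add: U_def d_def atLeastLessThan_conv_int)
  note P' = onbD[OF P] and Q' = onbD[OF Q] and T' = onbD[OF T] and U' = onbD[OF U]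
  define G where "G = ip_mat F P Q"
  have G: "G \<in> carrier_mat a b" using P'(1) Q'(1) by (simp add: G_def)
  \<comment> \<open>\<open>G\<close> is \<open>mat_adjoint (coeffG F n m)\<close>, and
    \<open>D\<close> is what remains of \<open>P\<close> after projection onto degrees less than
    \<open>m\<close> in \<open>w\<close>.\<close>
  define D where "D = P - cmat G * Q"
  have GQ: "cmat G * Q \<in> carrier_mat a 1" using G Q'(1) by auto
  have D: "D \<in> carrier_mat a 1" unfolding D_def using GQ by (rule minus_carrier_mat)
  have ip_D: "ip_mat F D X = ip_mat F P X - G * ip_mat F Q X" if "X \<in> carrier_mat l 1" for X l
    unfolding D_def ip_mat_diff_left[OF P'(1) GQ that] ip_mat_cmat_left[OF G Q'(1) that] ..
  have "perp D ({0..n - 1} \<times> {0..m - 1})"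
    unfolding D_def
    by (rule perp_diff[OF P'(1) GQ perp_mono[OF P'(3)] perp_cmat_mult[OF G Q'(1,3)]]) auto
  moreover have "ip_mat F D Q = 0\<^sub>m a b"
    unfolding ip_D[OF Q'(1)] Q'(4) G_def[symmetric] right_mult_one_mat[OF G] by (rule minus_r_inv_mat[OF G])
  ultimately have perp_D: "perp D ({0..n} \<times> {0..m - 1})"
    by (rule onb_complete[OF Q D])
  have col_D: "col_on ({0..n} \<times> {0..m}) D"
    unfolding D_def
    by (rule col_on_diff[OF P'(1) GQ P'(2) col_on_mono[OF col_on_cmat_mult[OF G Q'(1,2)]]]) auto
  \<comment> \<open>\<open>D\<close> lives on the full rectangle and is orthogonal to the part of
    degree less than \<open>m\<close> in \<open>w\<close>; the complement of that part has basis
    \<open>T\<close>.\<close>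
  have D_eq: "D = cmat (ip_mat F D T) * T"
    by (rule onb_expand_perp[OF T _ _ D col_D perp_D]) (use assms in auto)
  have "ip_mat F Q T = 0\<^sub>m b c"
    by (rule ip_mat_perp_right[OF T'(1) Q'(1) T'(3) Q'(2)])
  then have DT: "ip_mat F D T = ip_mat F P T"
    unfolding ip_D[OF T'(1)] using G ip_mat_carrier[OF P'(1) T'(1), of F] by simp
  \<comment> \<open>The pairing of \<open>D\<close> with \<open>U\<close> is now computed from both
    expressions for \<open>D\<close>. Here the entries of \<open>U\<close> have degree less than
    \<open>n\<close> in \<open>z\<close>.\<close>
  have "ip_mat F P U = 0\<^sub>m a d"
    by (rule ip_mat_perp_left[OF P'(1) U'(1) P'(3) U'(2)])
  then have "ip_mat F D U = - (G * ip_mat F Q U)"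
    unfolding ip_D[OF U'(1)] using G U'(1) by (intro eq_matI) auto
  moreover have "ip_mat F D U = ip_mat F P T * ip_mat F T U"
    using ip_mat_cmat_left[OF ip_mat_carrier[OF P'(1) T'(1)] T'(1) U'(1)] D_eq unfolding DT by simp
  moreover have "mat_adjoint (coeffG F n m) = G" "mat_adjoint (tcoeffG F n m) = ip_mat F T U"
    unfolding coeffG_def tcoeffG_def G_def P_def[symmetric] Q_def[symmetric] T_def[symmetric] U_def[symmetric]
    by (rule ip_mat_adjoint[OF Q'(1) P'(1)] ip_mat_adjoint[OF U'(1) T'(1)])+
  ultimately show ?thesis
    by (simp add: coeffI_def coeffK_def P_def Q_def T_def U_def)
qed

section \<open>Invertibility of \<open>coeffA\<close>\<close>

lemma phi_props:
  assumes "0 \<le> n" "n \<le> N" "0 \<le> l" "l \<le> m" "m \<le> M"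
  defines "S \<equiv> {0..<n} \<times> {0..m} \<union> {n} \<times> {0..l}"
  shows phi_lspan: "phi F n m l \<in> lspan S"
    and phi_lead: "0 < Poly_Mapping.lookup (phi F n m l) (n, l)"
    and ip_phi: "x \<in> lspan S \<Longrightarrow>
      iprod x (phi F n m l) = Poly_Mapping.lookup x (n, l) / Poly_Mapping.lookup (phi F n m l) (n, l)"
proof -
  have S: "finite S" "S \<subseteq> {0..N} \<times> {0..M}" "(n, l) \<in> S"
    using assms by auto
  show "phi F n m l \<in> lspan S" "0 < Poly_Mapping.lookup (phi F n m l) (n, l)"
    unfolding phi_def S_def[symmetric] by (rule ortho_poly_lspan[OF S] ortho_poly_lookup[OF S])+
  show "x \<in> lspan S \<Longrightarrow>
      iprod x (phi F n m l) = Poly_Mapping.lookup x (n, l) / Poly_Mapping.lookup (phi F n m l) (n, l)"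
    unfolding phi_def S_def[symmetric] by (rule ip_ortho_poly(1)[OF S])
qed

lemma coeffA_carrier: "coeffA F n m \<in> carrier_mat (nat (m + 1)) (nat (m + 1))"
  by (simp add: coeffA_def Phi_def)

text \<open>Row \<open>r\<close> belongs to superscript \<open>m - r\<close>, so multiplying its
  polynomial by \<open>z\<close> gives no monomial \<open>z^n w^j\<close> with
  \<open>j > m - r\<close>. The matrix is therefore upper triangular, and its diagonal entries are
  quotients of positive leading coefficients.\<close>

lemma coeffA_det:
  assumes n: "0 < n" "n \<le> N" and m: "0 \<le> m" "m \<le> M"
  shows "det (coeffA F n m) \<noteq> 0"
proof -
  \<comment> \<open>For \<open>c \<le> r\<close> the shifted polynomial lies in the span that
    defines \<open>phi F n m (m - int c)\<close>, so \<open>ip_phi\<close> reads off the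
    entry.\<close>
  have idx: "coeffA F n m $$ (r, c) =
      Poly_Mapping.lookup (phi F (n - 1) m (m - int r)) (n - 1, m - int c) /
      Poly_Mapping.lookup (phi F n m (m - int c)) (n, m - int c)"
    if rc: "c \<le> r" "r < nat (m + 1)" for r c
  proof -
    have l: "0 \<le> m - int r" "m - int r \<le> m" "0 \<le> m - int c" "m - int c \<le> m" using rc by linarith+
    have "phi F (n - 1) m (m - int r) \<in> lspan ({0..<n - 1} \<times> {0..m} \<union> {n - 1} \<times> {0..m - int r})"
      using assms l by (intro phi_lspan) auto
    then have "mono_zw (1, 0) * phi F (n - 1) m (m - int r) \<in> lspan ({0..<n} \<times> {0..m} \<union> {n} \<times> {0..m - int c})"
      by (rule mono_mult_lspan) (use rc in auto)
    then have "iprod (mono_zw (1, 0) * phi F (n - 1) m (m - int r)) (phi F n m (m - int c)) =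
        Poly_Mapping.lookup (mono_zw (1, 0) * phi F (n - 1) m (m - int r)) (n, m - int c) /
        Poly_Mapping.lookup (phi F n m (m - int c)) (n, m - int c)"
      using assms l by (intro ip_phi) auto
    moreover have "coeffA F n m $$ (r, c) =
        iprod ((mono_zw (1, 0) \<cdot>\<^sub>m Phi F (n - 1) m) $$ (r, 0)) (Phi F n m $$ (c, 0))"
      unfolding coeffA_def using rc
      by (intro ip_mat_index[of _ "nat (m + 1)" _ "nat (m + 1)"]) (auto simp: Phi_def)
    ultimately show ?thesis using rc by (simp add: Phi_def)
  qed
  have "upper_triangular (coeffA F n m)"
  proof (rule upper_triangularI)
    fix r c assume "c < r" "r < dim_row (coeffA F n m)"
    then have rc: "c < r" "r < nat (m + 1)" using coeffA_carrier[of n m] by auto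
    have "phi F (n - 1) m (m - int r) \<in> lspan ({0..<n - 1} \<times> {0..m} \<union> {n - 1} \<times> {0..m - int r})"
      using assms rc by (intro phi_lspan) auto
    then have "Poly_Mapping.lookup (phi F (n - 1) m (m - int r)) (n - 1, m - int c) = 0"
      by (rule lspan_lookup_eq_0) (use rc in auto)
    then show "coeffA F n m $$ (r, c) = 0" using idx[of c r] rc by simp
  qed
  moreover have "coeffA F n m $$ (r, r) \<noteq> 0" if "r < nat (m + 1)" for r
  proof -
    have l: "0 \<le> m - int r" "m - int r \<le> m" using that by linarith+
    have "0 < Poly_Mapping.lookup (phi F (n - 1) m (m - int r)) (n - 1, m - int r)"
      "0 < Poly_Mapping.lookup (phi F n m (m - int r)) (n, m - int r)"
      using assms l by (auto intro!: phi_lead)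
    then show ?thesis unfolding idx[OF order_refl that] by (metis divide_eq_0_iff order_less_irrefl)
  qed
  ultimately show ?thesis
    using det_upper_triangular[OF _ coeffA_carrier] coeffA_carrier[of n m]
    by (auto simp: diag_mat_def prod_list_zero_iff)
qed

section \<open>The second relation\<close>

lemma transpose_revPhi: "transpose_mat (revPhi F n m) = mrev (n, m) (Phi F n m)"
  unfolding revPhi_def mat_ldagger_def
  by (intro eq_matI) (auto simp: lrev_def Phi_def)

lemma mrev_onb:
  assumes "onb B S k X"
  shows "mrev b X \<in> carrier_mat k 1" "ip_mat F (mrev b X) (mrev b X) = 1\<^sub>m k"
proof -
  show "mrev b X \<in> carrier_mat k 1" using onbD(1)[OF assms] by simp
  have "map_mat cnj (1\<^sub>m k) = 1\<^sub>m k" by (intro eq_matI) auto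
  then show "ip_mat F (mrev b X) (mrev b X) = 1\<^sub>m k"
    unfolding ip_mat_mrev[OF onbD(1)[OF assms] onbD(1)[OF assms]] onbD(4)[OF assms] .
qed

lemma coeffI1_recurrence:
  assumes n: "0 < n" "n \<le> N" and m: "0 \<le> m" "m \<le> M"
  shows "coeffI1 F n m = - (mat_inv (map_mat cnj (coeffA F n m)) * mat_adjoint (hatE F n m)
             * coeffA F n m * coeffI F n m)
           + transpose_mat (coeffA F n m) * coeffI1 F (n - 1) m * tcoeffG F n m"
proof -
  define P where "P = Phi F n m"
  define Q where "Q = Phi F (n - 1) m"
  define T where "T = tPhi F n m"
  define U where "U = tPhi F (n - 1) m"
  define a c d where "a = nat (m + 1)" and "c = nat (n + 1)" and "d = nat n"
  have P: "onb ({0..n - 1} \<times> {0..m}) ({0..n} \<times> {0..m}) a P"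
    using Phi_onb[of n m] assms by (simp add: P_def a_def atLeastLessThan_conv_int)
  have Q: "onb ({0..n - 2} \<times> {0..m}) ({0..n - 1} \<times> {0..m}) a Q"
    using Phi_onb[of "n - 1" m] assms by (simp add: Q_def a_def atLeastLessThan_conv_int)
  have T: "onb ({0..n} \<times> {0..m - 1}) ({0..n} \<times> {0..m}) c T"
    using tPhi_onb[of m n] assms by (simp add: T_def c_def atLeastLessThan_conv_int)
  have U: "onb ({0..n - 1} \<times> {0..m - 1}) ({0..n - 1} \<times> {0..m}) d U"
    using tPhi_onb[of m "n - 1"] assms by (simp add: U_def d_def atLeastLessThan_conv_int)
  note P' = onbD[OF P] and Q' = onbD[OF Q] and T' = onbD[OF T] and U' = onbD[OF U]
  define Z where "Z = mono_zw (1, 0) \<cdot>\<^sub>m Q"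
  define R where "R = mrev (n - 1, m) Q"
  define X where "X = mrev (n, m) P"
  have Z: "Z \<in> carrier_mat a 1" and R: "R \<in> carrier_mat a 1" and X: "X \<in> carrier_mat a 1"
    using Q'(1) P'(1) by (simp_all add: Z_def R_def X_def)
  have RR: "ip_mat F R R = 1\<^sub>m a" unfolding R_def by (rule mrev_onb[OF Q])
  have ZZ: "ip_mat F Z Z = 1\<^sub>m a" unfolding Z_def ip_mat_smult_mono[OF Q'(1,1)] by (rule Q'(4))
  have mrev_R: "mrev (n - 1, m) R = Q" unfolding R_def using Q'(1) by (intro eq_matI) auto
  define E where "E = ip_mat F Z R"
  define A where "A = ip_mat F Z P"
  have E: "E \<in> carrier_mat a a" and A: "A \<in> carrier_mat a a"
    using Z R P'(1) by (simp_all add: E_def A_def)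
  have E': "E = hatE F n m"
    by (simp add: E_def hatE_def Z_def R_def Q_def transpose_revPhi)
  have A': "A = coeffA F n m"
    by (simp add: A_def coeffA_def Z_def P_def Q_def)

  have col_Z: "col_on ({1..n} \<times> {0..m}) Z"
    unfolding Z_def by (rule col_on_smult[OF Q'(1,2)]) auto
  have col_R: "col_on ({0..n - 1} \<times> {0..m}) R"
    unfolding R_def by (rule col_on_mrev[OF Q'(1,2)]) auto
  \<comment> \<open>\<open>Q\<close> is orthogonal to degrees up to \<open>n - 2\<close> in
    \<open>z\<close>. Both the shift by one and the reflection of degrees at \<open>n - 1\<close>
    carry \<open>{0..n - 2}\<close> to \<open>{1..n - 1}\<close>.\<close>
  have perp_Z: "perp Z ({1..n - 1} \<times> {0..m})"
    unfolding Z_def by (rule perp_smult_mono[OF Q'(1,3)]) auto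
  have perp_R: "perp R ({1..n - 1} \<times> {0..m})"
    unfolding R_def by (rule perp_mrev[OF Q'(1,3)]) auto

  define G where "G = Z - cmat E * R"
  have ER: "cmat E * R \<in> carrier_mat a 1" using E R by auto
  have G: "G \<in> carrier_mat a 1" unfolding G_def using ER by (rule minus_carrier_mat)
  have ip_G: "ip_mat F G Y = ip_mat F Z Y - E * ip_mat F R Y" if "Y \<in> carrier_mat l 1" for Y l
    unfolding G_def ip_mat_diff_left[OF Z ER that] ip_mat_cmat_left[OF E R that] ..
  have GR: "ip_mat F G R = 0\<^sub>m a a"
    unfolding ip_G[OF R] RR E_def[symmetric] right_mult_one_mat[OF E] by (rule minus_r_inv_mat[OF E])
  have "perp G ({0..n - 1} \<times> {0..m})"
  proof -
    \<comment> \<open>Only degree 0 in \<open>z\<close> is missing. Reversal at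
      \<open>(n - 1, m)\<close> turns it into the top degree \<open>n - 1\<close> and
      \<open>R\<close> into \<open>Q\<close>, so completeness of \<open>Q\<close> applies; reversing
      once more returns to \<open>G\<close>.\<close>
    let ?H = "mrev (n - 1, m) G"
    have H: "?H \<in> carrier_mat a 1" using G by simp
    have "perp G ({1..n - 1} \<times> {0..m})"
      unfolding G_def by (rule perp_diff[OF Z ER perp_Z perp_cmat_mult[OF E R perp_R]])
    then have "perp ?H ({0..n - 2} \<times> {0..m})"
      by (rule perp_mrev[OF G]) auto
    moreover have "ip_mat F ?H Q = 0\<^sub>m a a"
      using ip_mat_mrev[OF G R, of "(n - 1, m)"] unfolding GR mrev_R by (auto intro!: eq_matI)
    ultimately have "perp ?H ({0..n - 1} \<times> {0..m})"
      by (rule onb_complete[OF Q H])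
    then have "perp (mrev (n - 1, m) ?H) ({0..n - 1} \<times> {0..m})"
      by (rule perp_mrev[OF H]) auto
    moreover have "mrev (n - 1, m) ?H = G" by (intro eq_matI) auto
    ultimately show ?thesis by simp
  qed
  moreover have "col_on ({0..n} \<times> {0..m}) G"
    unfolding G_def
    by (rule col_on_diff[OF Z ER col_on_mono[OF col_Z] col_on_mono[OF col_on_cmat_mult[OF E R col_R]]]) auto
  ultimately have "G = cmat (ip_mat F G P) * P"
    by (intro onb_expand_perp[OF P _ _ G]) (use assms in auto)
  moreover have RP: "ip_mat F R P = 0\<^sub>m a a"
    by (rule ip_mat_perp_right[OF P'(1) R P'(3) col_R])
  then have "ip_mat F G P = A"
    unfolding ip_G[OF P'(1)] A_def[symmetric] using E A by simp
  ultimately have G_eq: "G = cmat A * P" by simp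

  \<comment> \<open>The Gram matrix of \<open>G\<close> is computed twice: from
    \<open>cmat A * P\<close> with \<open>P\<close> orthonormal, and from
    \<open>Z - cmat E * R\<close>, where orthogonality of \<open>G\<close> to \<open>R\<close>
    removes one of the two terms on the left.\<close>
  have EE: "A * mat_adjoint A = 1\<^sub>m a - E * mat_adjoint E"
  proof -
    have "ip_mat F G G = A * mat_adjoint A"
      unfolding G_eq ip_mat_cmat_left[OF A P'(1) G[unfolded G_eq]] ip_mat_cmat_right[OF A P'(1,1)] P'(4)
      using A by simp
    moreover have "ip_mat F R G = 0\<^sub>m a a"
      using ip_mat_adjoint[OF G R] unfolding GR by simp
    then have "ip_mat F G G = ip_mat F Z G"
      unfolding ip_G[OF G] using E ip_mat_carrier[OF Z G, of F] by simp
    moreover have "ip_mat F Z G = 1\<^sub>m a - E * mat_adjoint E"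
      unfolding G_def ip_mat_diff_right[OF Z ER Z] ip_mat_cmat_right[OF E R Z] ZZ E_def[symmetric] ..
    ultimately show ?thesis by simp
  qed

  \<comment> \<open>The dagger in the inner product undoes the one in the reversal, so an entry of
    \<open>E\<close> is \<open>F\<close> of a fixed monomial times a product of two entries of
    \<open>Q\<close>, and these commute.\<close>
  have "transpose_mat E = E"
  proof (rule eq_matI)
    fix i j assume "i < dim_row E" "j < dim_col E"
    then have ij: "i < a" "j < a" using E by auto
    have "E $$ (i, j) = F (mono_zw (1, 0) * Q $$ (i, 0) * (mono_zw (1 - n, - m) * Q $$ (j, 0)))" if "i < a" "j < a" for i j
      unfolding E_def ip_mat_index[OF Z R that]
      using Q'(1) that by (simp add: Z_def R_def ip_def lrev_def ldagger_mult)
    from this[OF ij] this[OF ij(2,1)] have "E $$ (j, i) = E $$ (i, j)" by (simp add: ac_simps)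
    then show "transpose_mat E $$ (i, j) = E $$ (i, j)" using ij E by simp
  qed (use E in auto)
  then have conj_E: "map_mat cnj E = mat_adjoint E"
    using transpose_map_cnj[of E] by (metis map_mat_transpose)

  have AX: "cmat (map_mat cnj A) * X = R - cmat (mat_adjoint E) * Z"
  proof -
    \<comment> \<open>Reversal at degree \<open>(n, m)\<close> exchanges \<open>Z\<close> and
      \<open>R\<close>; applied to the two expressions for \<open>G\<close>, it gives the
      claim.\<close>
    have "mrev (n, m) Z = R"
      unfolding Z_def R_def using Q'(1)
      by (intro eq_matI) (auto simp: lrev_mono_mult)
    moreover have "mrev (n, m) R = Z"
      unfolding Z_def R_def using Q'(1)
      by (intro eq_matI) (auto intro!: poly_mapping_eqI simp: lookup_lrev)
    moreover have "mrev (n, m) G = mrev (n, m) Z - mrev (n, m) (cmat E * R)"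
      unfolding G_def by (rule mrev_diff[OF Z ER])
    ultimately have "mrev (n, m) G = R - cmat (map_mat cnj E) * Z"
      unfolding mrev_cmat_mult[OF E R] by simp
    then show ?thesis
      unfolding G_eq mrev_cmat_mult[OF A P'(1)] X_def conj_E .
  qed
  define B where "B = map_mat cnj A"
  define Es where "Es = mat_adjoint E"
  have B: "B \<in> carrier_mat a a" and Es: "Es \<in> carrier_mat a a" using A E by (simp_all add: B_def Es_def)
  define I where "I = ip_mat F P T"
  define W where "W = ip_mat F R T"
  have I: "I \<in> carrier_mat a c" and W: "W \<in> carrier_mat a c"
    using P'(1) R T'(1) by (simp_all add: I_def W_def)

  \<comment> \<open>From here on everything is paired with \<open>T\<close>, and \<open>Z\<close> is
    eliminated at the level of complex matrices.\<close>
  have ZT: "ip_mat F Z T = A * I + E * W"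
  proof -
    have "ip_mat F Z T - E * W = A * I"
      unfolding W_def I_def ip_G[OF T'(1), symmetric] G_eq by (rule ip_mat_cmat_left[OF A P'(1) T'(1)])
    moreover have "ip_mat F Z T = (ip_mat F Z T - E * W) + E * W"
      using E W Z T'(1) by (intro eq_matI) auto
    ultimately show ?thesis by simp
  qed
  have BX: "B * ip_mat F X T = W - Es * (A * I + E * W)"
  proof -
    have EsZ: "cmat Es * Z \<in> carrier_mat a 1" using Es Z by auto
    have "B * ip_mat F X T = ip_mat F (cmat B * X) T"
      by (rule ip_mat_cmat_left[OF B X T'(1), symmetric])
    also have "\<dots> = W - Es * ip_mat F Z T"
      unfolding B_def AX Es_def[symmetric] W_def
      unfolding ip_mat_diff_left[OF R EsZ T'(1)] ip_mat_cmat_left[OF Es Z T'(1)] ..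
    finally show ?thesis unfolding ZT .
  qed
  \<comment> \<open>The conjugate of \<open>EE\<close>. It rewrites \<open>W - Es * (E * W)\<close>
    with the left factor \<open>B\<close>, which cancels against \<open>V\<close> at the
    end.\<close>
  have BA: "B * transpose_mat A = 1\<^sub>m a - Es * E"
  proof -
    have "B * transpose_mat A = map_mat cnj (A * mat_adjoint A)"
      unfolding B_def cnj.mat_hom_mult[OF A mat_adjoint_carrier[OF A]] map_cnj_mat_adjoint ..
    also have "\<dots> = map_mat cnj (1\<^sub>m a) - map_mat cnj (E * mat_adjoint E)"
      unfolding EE using E by (intro eq_matI) auto
    also have "map_mat cnj (E * mat_adjoint E) = Es * E"
      unfolding cnj.mat_hom_mult[OF E mat_adjoint_carrier[OF E]] map_cnj_mat_adjoint conj_E Es_def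
      using \<open>transpose_mat E = E\<close> by simp
    also have "map_mat cnj (1\<^sub>m a) = 1\<^sub>m a" by (intro eq_matI) auto
    finally show ?thesis .
  qed
  have BX': "B * ip_mat F X T = - (Es * (A * I)) + B * (transpose_mat A * W)"
  proof -
    have "B * (transpose_mat A * W) = (1\<^sub>m a - Es * E) * W"
      using assoc_mult_mat[OF B transpose_carrier_mat[THEN iffD2, OF A] W] BA by simp
    also have "\<dots> = W - Es * E * W"
      using minus_mult_distrib_mat[OF one_carrier_mat mult_carrier_mat[OF Es E] W] W by simp
    also have "Es * E * W = Es * (E * W)" by (rule assoc_mult_mat[OF Es E W])
    finally have 1: "B * (transpose_mat A * W) = W - Es * (E * W)" .
    have 2: "Es * (A * I + E * W) = Es * (A * I) + Es * (E * W)"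
      by (rule mult_add_distrib_mat[OF Es mult_carrier_mat[OF A I] mult_carrier_mat[OF E W]])
    show ?thesis
      unfolding BX 1 2 using Es A I E W by (intro eq_matI) auto
  qed

  \<comment> \<open>\<open>ip_mat F R U\<close> is \<open>coeffI1 F (n - 1) m\<close>, as
    \<open>R\<close> is the transposed reversal of \<open>Phi F (n - 1) m\<close>.\<close>
  have W_eq: "W = ip_mat F R U * tcoeffG F n m"
  proof -
    let ?C = "ip_mat F R U"
    have C: "?C \<in> carrier_mat a d" using R U'(1) by simp
    have CU: "cmat ?C * U \<in> carrier_mat a 1" using C U'(1) by auto
    have D: "R - cmat ?C * U \<in> carrier_mat a 1" using CU by (rule minus_carrier_mat)
    have "col_on ({0..n - 1} \<times> {0..m - 1}) (R - cmat ?C * U)"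
      by (rule onb_expand[OF U R col_R])
    then have "ip_mat F (R - cmat ?C * U) T = 0\<^sub>m a c"
      by (intro ip_mat_perp_right[OF T'(1) D T'(3)]) (erule col_on_mono, auto)
    then have zero: "W - ?C * ip_mat F U T = 0\<^sub>m a c"
      unfolding ip_mat_diff_left[OF R CU T'(1)] ip_mat_cmat_left[OF C U'(1) T'(1)] W_def .
    have CUT: "?C * ip_mat F U T \<in> carrier_mat a c"
      by (rule mult_carrier_mat[OF C ip_mat_carrier[OF U'(1) T'(1)]])
    have "W = (W - ?C * ip_mat F U T) + ?C * ip_mat F U T"
      using W CUT by (intro eq_matI) auto
    then have "W = ?C * ip_mat F U T" unfolding zero using CUT by simp
    then show ?thesis by (simp add: tcoeffG_def U_def T_def)
  qed

  have "det B = cnj (det A)" unfolding B_def by (rule cnj.hom_det)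
  then have "det B \<noteq> 0" using coeffA_det[OF n m] unfolding A' by simp
  note inv = mat_inv_mult[OF B this]
  define V where "V = mat_inv B"
  note inv = inv[folded V_def]
  have XT: "ip_mat F X T \<in> carrier_mat a c" by (rule ip_mat_carrier[OF X T'(1)])
  have tA: "transpose_mat A \<in> carrier_mat a a" using A by simp
  have AI: "A * I \<in> carrier_mat a c" and tAW: "transpose_mat A * W \<in> carrier_mat a c"
    using A I tA W by auto
  have cancel: "V * (B * Y) = Y" if "Y \<in> carrier_mat a c" for Y
    using assoc_mult_mat[OF inv(1) B that] inv(2) that by simp
  have "ip_mat F X T = V * (- (Es * (A * I)) + B * (transpose_mat A * W))"
    using cancel[OF XT] unfolding BX' by simp
  also have "\<dots> = V * (- (Es * (A * I))) + V * (B * (transpose_mat A * W))"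
    by (rule mult_add_distrib_mat[OF inv(1)]) (use Es AI B tAW in auto)
  also have "V * (- (Es * (A * I))) = - (V * (Es * (A * I)))"
    using inv(1) Es by (intro uminus_mult_right_mat) auto
  also have "V * (Es * (A * I)) = V * Es * A * I"
    using assoc_mult_mat[OF inv(1) Es AI] assoc_mult_mat[OF mult_carrier_mat[OF inv(1) Es] A I] by simp
  also have "V * (B * (transpose_mat A * W)) = transpose_mat A * W" by (rule cancel[OF tAW])
  also have "transpose_mat A * W = transpose_mat A * ip_mat F R U * tcoeffG F n m"
  proof -
    have "tcoeffG F n m \<in> carrier_mat d c"
      unfolding tcoeffG_def U_def[symmetric] T_def[symmetric] by (rule ip_mat_carrier[OF U'(1) T'(1)])
    from assoc_mult_mat[OF tA ip_mat_carrier[OF R U'(1)] this] show ?thesis unfolding W_eq by simp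
  qed
  finally show ?thesis
    unfolding coeffI1_def transpose_revPhi coeffI_def A'[symmetric] E'[symmetric]
      P_def[symmetric] Q_def[symmetric] T_def[symmetric] U_def[symmetric]
    by (simp add: X_def R_def V_def B_def Es_def I_def)
qed

end

subsection \<open>Reduction to a globally hermitian functional\<close>

lemma Laurent_space_conv_lspan: "Laurent_space N M = lspan ({- N..N} \<times> {- M..M})"
proof -
  have "{(i, j). \<bar>i\<bar> \<le> N \<and> \<bar>j\<bar> \<le> M} = {- N..N} \<times> {- M..M}" by auto
  then show ?thesis by (simp add: Laurent_space_def)
qed

text \<open>Differences of exponents from \<open>{0..N} \<times> {0..M}\<close> stay in the
  symmetric box, so such inner products involve \<open>L\<close> only where it is specified.\<close>

lemma mult_ldagger_in_Laurent_space:
  assumes "p \<in> lspan ({0..N} \<times> {0..M})" "q \<in> lspan ({0..N} \<times> {0..M})"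
  shows "p * ldagger q \<in> Laurent_space N M"
proof -
  have "Poly_Mapping.keys (ldagger q) = uminus ` Poly_Mapping.keys q"
    by (force simp: in_keys_iff ldagger.rep_eq image_iff intro: exI [of _ "- k" for k])
  then show ?thesis
    using assms keys_mult[of p "ldagger q"]
    unfolding Laurent_space_conv_lspan lspan_iff by fastforce
qed

text \<open>
  Only the values of \<open>L\<close> on monomials inside the box are used, so the extension by zero is linear and
  hermitian on all Laurent polynomials.
\<close>

lemma pd_functional_extension:
  assumes lin: "linear_functional N M L" and pd: "positive_definite N M L"
  obtains F where "pd_functional N M F" "\<And>p. p \<in> Laurent_space N M \<Longrightarrow> L p = F p"
proof
  define K where "K = {- N..N} \<times> {- M..M}"
  define F where "F p = (\<Sum>k\<in>K. Poly_Mapping.lookup p k * L (mono_zw k))" for p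
  have K: "finite K" by (simp add: K_def)
  have space: "Laurent_space N M = lspan K" by (simp add: Laurent_space_conv_lspan K_def)
  have L_add: "L (p + q) = L p + L q" if "p \<in> lspan K" "q \<in> lspan K" for p q
    using lin that unfolding linear_functional_def space by blast
  have L_scale: "L (lscale c p) = c * L p" if "p \<in> lspan K" for c p
    using lin that unfolding linear_functional_def space by blast
  have L_mono: "L (mono_zw (- k)) = cnj (L (mono_zw k))" if "k \<in> K" for k
  proof -
    obtain i j where k: "k = (i, j)" by (cases k)
    have "\<bar>i\<bar> \<le> N \<and> \<bar>j\<bar> \<le> M"
      using that unfolding k K_def by auto
    then show ?thesis using lin unfolding linear_functional_def k by simp
  qed
  have F_add: "F (p + q) = F p + F q" for p q
    by (simp add: F_def lookup_add distrib_right sum.distrib)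
  have F_lconst: "F (lconst c * p) = c * F p" for c p
    by (simp add: F_def sum_distrib_left mult.assoc)
  have F_mono: "F (mono_zw k) = L (mono_zw k)" if "k \<in> K" for k
    using that K by (simp add: F_def lookup_mono if_distrib[of "\<lambda>x. x * _"] cong: if_cong)
  show eq: "L p = F p" if "p \<in> Laurent_space N M" for p
  proof -
    \<comment> \<open>Membership is carried through the induction because \<open>L\<close> is known
      to be linear on \<open>lspan K\<close> only.\<close>
    have "p \<in> lspan K \<and> L p = F p"
      using that unfolding space
    proof (induction rule: laurent.span_induct)
      case base
      have "L 0 = 0" "F 0 = 0"
        using L_scale[of 0 0] F_lconst[of 0 0] by (simp_all add: laurent.span_zero)
      then show "laurent.subspace {p. p \<in> lspan K \<and> L p = F p}"
        unfolding laurent.subspace_def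
        by (auto simp: L_add F_add L_scale F_lconst[unfolded lconst_mult_conv_lscale]
            laurent.span_zero laurent.span_add laurent.span_scale)
    qed (auto simp: F_mono laurent.span_base)
    then show ?thesis ..
  qed
  show "pd_functional N M F"
  proof
    show "F (ldagger p) = cnj (F p)" for p
      unfolding F_def cnj_sum
    \<comment> \<open>\<open>K\<close> is symmetric under negation, and \<open>L\<close> is
      hermitian on its monomials.\<close>
    proof (rule sum.reindex_bij_witness[of _ uminus uminus])
      fix k assume "k \<in> K"
      then show "cnj (Poly_Mapping.lookup p (- k) * L (mono_zw (- k))) =
          Poly_Mapping.lookup (ldagger p) k * L (mono_zw k)"
        by (simp add: L_mono ldagger.rep_eq)
    qed (auto simp: K_def)
    show "0 < F (p * ldagger p)" if "p \<in> Poly_space N M" "p \<noteq> 0" for p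
    proof -
      have "L (p * ldagger p) = F (p * ldagger p)"
        using that(1) by (intro eq mult_ldagger_in_Laurent_space) (simp_all add: Poly_space_def)
      moreover have "0 < L (p * ldagger p)" using that pd by (simp add: positive_definite_def)
      ultimately show ?thesis by simp
    qed
  qed (fact F_add F_lconst)+
qed

section \<open>Transfer of polynomials and coefficients between \<open>L\<close> and its
  extension\<close>

context pd_functional
begin

context
  fixes L :: "laurent \<Rightarrow> complex"
  assumes L_eq: "\<And>p. p \<in> Laurent_space N M \<Longrightarrow> L p = F p"
begin

lemma ip_eq:
  assumes "p \<in> lspan ({0..N} \<times> {0..M})" "q \<in> lspan ({0..N} \<times> {0..M})"
  shows "ip L p q = iprod p q"
  using L_eq mult_ldagger_in_Laurent_space[OF assms] by (simp add: ip_def)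

text \<open>The defining conditions pair only polynomials of the box, so the two definite
  descriptions have equivalent bodies.\<close>

lemma ortho_poly_eq:
  assumes "S \<subseteq> {0..N} \<times> {0..M}"
  shows "ortho_poly L S t = ortho_poly F S t"
proof -
  have mem: "p \<in> lspan ({0..N} \<times> {0..M})" if "p \<in> lspan S" for p
    using that lspan_mono[OF assms] by blast
  have *: "mono_zw s \<in> lspan S" if "s \<in> S" for s
    using that by (intro laurent.span_base) auto
  have "(p \<in> lspan S \<and> 0 < Poly_Mapping.lookup p t \<and> ip L p p = 1 \<and> (\<forall>s\<in>S - {t}. ip L p (mono_zw s) = 0)) =
      (p \<in> lspan S \<and> 0 < Poly_Mapping.lookup p t \<and> iprod p p = 1 \<and> (\<forall>s\<in>S - {t}. iprod p (mono_zw s) = 0))"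
    for p
  proof (cases "p \<in> lspan S")
    case True
    have "ip L p (mono_zw s) = iprod p (mono_zw s)" if "s \<in> S - {t}" for s
      using that by (intro ip_eq mem True *) auto
    then show ?thesis unfolding ip_eq[OF mem[OF True] mem[OF True]] by metis
  qed simp
  then show ?thesis unfolding ortho_poly_def by presburger
qed

lemma Phi_eq:
  assumes "0 \<le> n" "n \<le> N" "m \<le> M"
  shows "Phi L n m = Phi F n m"
  unfolding Phi_def phi_def
  by (rule cong_mat) (use assms in \<open>auto intro!: ortho_poly_eq\<close>)

lemma tPhi_eq:
  assumes "0 \<le> m" "n \<le> N" "m \<le> M"
  shows "tPhi L n m = tPhi F n m"
  unfolding tPhi_def tphi_def
  by (rule cong_mat) (use assms in \<open>auto intro!: ortho_poly_eq\<close>)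

lemma ip_mat_eq:
  assumes "X \<in> carrier_mat a 1" "col_on S X" "Y \<in> carrier_mat b 1" "col_on T Y"
    and "S \<subseteq> {0..N} \<times> {0..M}" "T \<subseteq> {0..N} \<times> {0..M}"
  shows "ip_mat L X Y = ip_mat F X Y"
proof (rule mat_eq_ip_mat_index[OF assms(1,3) ip_mat_carrier[OF assms(1,3)]])
  fix i j assume ij: "i < a" "j < b"
  then have "X $$ (i, 0) \<in> lspan ({0..N} \<times> {0..M})" "Y $$ (j, 0) \<in> lspan ({0..N} \<times> {0..M})"
    using col_on_mono[OF assms(2,5)] col_on_mono[OF assms(4,6)] assms(1,3) by (auto simp: col_on_def)
  then show "ip L (X $$ (i, 0)) (Y $$ (j, 0)) = ip_mat F X Y $$ (i, j)"
    unfolding ip_mat_index[OF assms(1,3) ij] by (rule ip_eq)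
qed

lemma coeff_eq:
  assumes n: "0 \<le> n" "n \<le> N" and m: "0 \<le> m" "m \<le> M"
  shows "coeffI L n m = coeffI F n m" "coeffI1 L n m = coeffI1 F n m"
    and "coeffG L n m = coeffG F n m" "tcoeffG L n m = tcoeffG F n m" "coeffK L n m = coeffK F n m"
proof -
  note * = onbD(1,2)[OF Phi_onb] onbD(1,2)[OF tPhi_onb]
  have rev: "mrev (n, m) (Phi F n m) \<in> carrier_mat (nat (m + 1)) 1"
    "col_on ({0..n} \<times> {0..m}) (mrev (n, m) (Phi F n m))"
    using *(1)[of n m] assms by (auto intro!: col_on_mrev[OF *(1,2)])
  have rev_eq: "transpose_mat (revPhi L n m) = mrev (n, m) (Phi F n m)"
    using Phi_eq[of n m] assms transpose_revPhi[of n m] by (simp add: revPhi_def)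
  show "coeffI L n m = coeffI F n m"
    unfolding coeffI_def Phi_eq[OF n m(2)] tPhi_eq[OF m(1) n(2) m(2)]
    by (rule ip_mat_eq[OF *]) (use assms in auto)
  show "coeffI1 L n m = coeffI1 F n m"
    unfolding coeffI1_def rev_eq transpose_revPhi tPhi_eq[OF m(1) n(2) m(2)]
    by (rule ip_mat_eq[OF rev *(3,4)]) (use assms in auto)
  have m': "m - 1 \<le> M" and n': "n - 1 \<le> N" using assms by auto
  show "coeffG L n m = coeffG F n m"
    unfolding coeffG_def Phi_eq[OF n m(2)] Phi_eq[OF n m']
    by (rule ip_mat_eq[OF *(1,2,1,2)]) (use assms in auto)
  show "tcoeffG L n m = tcoeffG F n m"
    unfolding tcoeffG_def tPhi_eq[OF m(1) n(2) m(2)] tPhi_eq[OF m(1) n' m(2)]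
    by (rule ip_mat_eq[OF *(3,4,3,4)]) (use assms in auto)
  show "coeffK L n m = coeffK F n m"
    unfolding coeffK_def Phi_eq[OF n m'] tPhi_eq[OF m(1) n' m(2)]
    by (rule ip_mat_eq[OF *]) (use assms in auto)
qed

text \<open>The factor \<open>z\<close> does not leave the box: the entries of
  \<open>Phi F (n - 1) m\<close> have degree at most \<open>n - 1\<close> in \<open>z\<close>, and
  \<open>n \<le> N\<close>.\<close>

lemma shifted_coeff_eq:
  assumes n: "0 < n" "n \<le> N" and m: "0 \<le> m" "m \<le> M"
  shows "hatE L n m = hatE F n m" "coeffA L n m = coeffA F n m"
proof -
  note * = onbD(1,2)[OF Phi_onb]
  have Z: "mono_zw (1, 0) \<cdot>\<^sub>m Phi F (n - 1) m \<in> carrier_mat (nat (m + 1)) 1"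
    "col_on ({1..n} \<times> {0..m}) (mono_zw (1, 0) \<cdot>\<^sub>m Phi F (n - 1) m)"
    using *(1)[of "n - 1" m] assms by (auto intro!: col_on_smult[OF *])
  have R: "mrev (n - 1, m) (Phi F (n - 1) m) \<in> carrier_mat (nat (m + 1)) 1"
    "col_on ({0..n - 1} \<times> {0..m}) (mrev (n - 1, m) (Phi F (n - 1) m))"
    using *(1)[of "n - 1" m] assms by (auto intro!: col_on_mrev[OF *])
  have Phi': "Phi L (n - 1) m = Phi F (n - 1) m" and Phi: "Phi L n m = Phi F n m"
    using Phi_eq assms by auto
  have rev_eq: "transpose_mat (revPhi L (n - 1) m) = mrev (n - 1, m) (Phi F (n - 1) m)"
    using Phi' transpose_revPhi[of "n - 1" m] by (simp add: revPhi_def)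
  show "hatE L n m = hatE F n m"
    unfolding hatE_def rev_eq Phi' transpose_revPhi
    by (rule ip_mat_eq[OF Z R]) (use assms in auto)
  show "coeffA L n m = coeffA F n m"
    unfolding coeffA_def Phi Phi'
    by (rule ip_mat_eq[OF Z *]) (use assms in auto)
qed

end

end

theorem lemma3p15:
  fixes L :: "laurent \<Rightarrow> complex" and N M :: int
  assumes "linear_functional N M L" and "positive_definite N M L"
  shows "(\<forall>n m. 0 \<le> n \<and> n \<le> N \<and> 0 \<le> m \<and> m \<le> M \<longrightarrow>
            coeffI L n m * mat_adjoint (tcoeffG L n m)
              = - (mat_adjoint (coeffG L n m) * coeffK L n m)) \<and>
         (\<forall>n m. 0 < n \<and> n \<le> N \<and> 0 \<le> m \<and> m \<le> M \<longrightarrow>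
            coeffI1 L n m
              = - (mat_inv (map_mat cnj (coeffA L n m)) * mat_adjoint (hatE L n m)
                    * coeffA L n m * coeffI L n m)
                + transpose_mat (coeffA L n m) * coeffI1 L (n - 1) m * tcoeffG L n m)"
proof -
  obtain F where F: "pd_functional N M F" and eq: "\<And>p. p \<in> Laurent_space N M \<Longrightarrow> L p = F p"
    using pd_functional_extension[OF assms] by blast
  interpret pd_functional N M F by (rule F)
  show ?thesis
  proof (intro conjI allI impI)
    fix n m assume "0 \<le> n \<and> n \<le> N \<and> 0 \<le> m \<and> m \<le> M"
    then show "coeffI L n m * mat_adjoint (tcoeffG L n m) = - (mat_adjoint (coeffG L n m) * coeffK L n m)"
      using coeffI_tcoeffG[of n m] by (simp add: coeff_eq[OF eq])
  next
    fix n m assume "0 < n \<and> n \<le> N \<and> 0 \<le> m \<and> m \<le> M"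
    then show "coeffI1 L n m
        = - (mat_inv (map_mat cnj (coeffA L n m)) * mat_adjoint (hatE L n m) * coeffA L n m * coeffI L n m)
          + transpose_mat (coeffA L n m) * coeffI1 L (n - 1) m * tcoeffG L n m"
      using coeffI1_recurrence[of n m] by (simp add: coeff_eq[OF eq] shifted_coeff_eq[OF eq])
  qed
qed

end
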